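(* Let $F \in \mathcal{F}[a,b]$, and let $\{\mathcal{K}_n\}_{n\in\mathbb{N}}$, $\mathcal{K}_n:[a,b]\times[a,b]\to\mathbb{R}$, be a sequence of kernels such that $\mathcal{K}_n(x,\cdot)$ is of bounded variation on $[a,b]$ for every $x\in[a,b]$ and every $n$. Let $T_nF$, $\alpha_n$, $\beta_n$ and $M$ be as defined in the context. Then: (i) For all $x\in[a,b]$, $\delta>0$ and $n\in\mathbb{N}$, $$\mathrm{haus}\big(T_nF(x),F(x)\big)\le \omega(v_F,x,4\delta)\,M(x)+\|F\|_\infty\big(2\beta_n(x,\delta)+\alpha_n(x)\big).$$ (ii) If $x\in[a,b]$ is such that $\lim_{n\to\infty}\alpha_n(x)=0$, $\lim_{n\to\infty}\beta_n(x,\delta)=0$ for all sufficiently small $\delta>0$, $M(x)<\infty$, and $F$ is continuous at $x$, then $$\lim_{n\to\infty}\mathrm{haus}\big(T_nF(x),F(x)\big)=0.$$ (iii) If $F$ is continuous at all points of a closed interval $I\subseteq[a,b]$, if $\lim_{n\to\infty}\alpha_n(x)=0$ and $\lim_{n\to\infty}\beta_n(x,\delta)=0$ uniformly in $x\in I$ for every sufficiently small $\delta>0$, and if $M$ is bounded on $I$, then $\mathrm{haus}(T_nF(x),F(x))\to 0$ as $n\to\infty$ uniformly in $x\in I$.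
   Context: Fix a norm $|\cdot|$ on $\mathbb{R}^d$ and $[a,b]\subset\mathbb{R}$. $\mathrm{K}(\mathbb{R}^d)$ is the collection of non-empty compact subsets of $\mathbb{R}^d$ with the Hausdorff metric $\mathrm{haus}$ induced by $|\cdot|$; $|A|=\mathrm{haus}(A,\{0\})$. Continuity of $F:[a,b]\to\mathrm{K}(\mathbb{R}^d)$ is with respect to $\mathrm{haus}$. Metric pairs and chains: for $A,B\in\mathrm{K}(\mathbb{R}^d)$ and $y\in\mathbb{R}^d$, $\Pi_B(y)=\{b\in B: |y-b|=\mathrm{dist}(y,B)\}$ and $\Pi(A,B)=\{(p,q)\in A\times B: p\in\Pi_A(q)\text{ or }q\in\Pi_B(p)\}$. $\mathrm{CH}(A_0,\dots,A_n)=\{(y_0,\dots,y_n): (y_i,y_{i+1})\in\Pi(A_i,A_{i+1}),\ i=0,\dots,n-1\}$ is the set of metric chains. Variation: for $F:[a,b]\to \mathrm{K}(\mathbb{R}^d)$, $V_a^b(F)=\sup\sum_i \mathrm{haus}(F(x_i),F(x_{i-1}))$ over all partitions of $[a,b]$; $F$ is of bounded variation if $V_a^b(F)<\infty$; $v_F(x)=V_a^x(F)$, $x\in[a,b]$. $\|F\|_\infty=\sup_{x\in[a,b]}|F(x)|$. $\mathcal{F}[a,b]$ is the class of all $F:[a,b]\to\mathrm{K}(\mathbb{R}^d)$ of bounded variation whose graph $\{(x,y): x\in[a,b],\ y\in F(x)\}$ is compact. Local modulus of continuity: $\omega(v_F,x,\delta)=\sup\{|v_F(x_1)-v_F(x_2)|: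 x_1,x_2\in[x-\delta/2,x+\delta/2]\cap[a,b]\}$. Weighted metric integral: for $\kappa:[a,b]\to\mathbb{R}$ and a partition $\chi=\{a=x_0<\dots<x_n=b\}$ with $|\chi|=\max_i(x_{i+1}-x_i)$, let $S_\chi^{\kappa}F=\{\sum_{i=0}^{n-1}(x_{i+1}-x_i)\kappa(x_i)y_i: (y_0,\dots,y_{n-1})\in\mathrm{CH}(F(x_0),\dots,F(x_{n-1}))\}$. The weighted metric integral $(\mathcal{M}_\kappa)\int_a^b\kappa(t)F(t)\,dt$ is the upper Kuratowski limit of $S_\chi^\kappa F$ as $|\chi|\to0$, i.e. the set of all limits of convergent sequences $z_k\in S_{\chi_k}^\kappa F$ with $|\chi_k|\to0$. Operators: with $\kappa_{n,x}(t)=\mathcal{K}_n(x,t)$, $T_nF(x)=(\mathcal{M}_{\kappa_{n,x}})\int_a^b\kappa_{n,x}(t)F(t)\,dt$, $x\in[a,b]$. Further notation: $\alpha_n(x)=\left|\int_a^b\mathcal{K}_n(x,t)\,dt-1\right|$; $\beta_n(x,\delta)=\int_{\{t\in[a,b]:|x-t|\ge\delta\}}|\mathcal{K}_n(x,t)|\,dt$ for $\delta>0$; and for each $x\in[a,b]$, $M(x)\in[0,\infty]$ is such that $\int_a^b|\mathcal{K}_n(x,t)|\,dt\le M(x)$ for all $n\in\mathbb{N}$. *)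

theory Defs
  imports "HOL-Analysis.Analysis"
begin

text \<open>
  The norm on \<open>\<real>\<^sup>d\<close> is an arbitrary function \<open>N\<close> on \<open>real ^ 'd\<close> satisfying the norm axioms; it is in
  general not the library's Euclidean \<open>norm\<close>.  All notions that depend on the metric (distance to a
  set, projections, Hausdorff distance) are formed with \<open>N\<close>.  Compactness and convergence of
  sequences are the library's: all norms on \<open>\<real>\<^sup>d\<close> induce the same topology.
\<close>

definition is_norm :: "(real ^ 'd \<Rightarrow> real) \<Rightarrow> bool" where
  "is_norm N \<longleftrightarrow>
     (\<forall>y. N y = 0 \<longleftrightarrow> y = 0) \<and>
     (\<forall>r y. N (r *\<^sub>R y) = \<bar>r\<bar> * N y) \<and>
     (\<forall>y z. N (y + z) \<le> N y + N z)"

definition dist_set :: "(real ^ 'd \<Rightarrow> real) \<Rightarrow> real ^ 'd \<Rightarrow> (real ^ 'd) set \<Rightarrow> real" where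
  "dist_set N y B = (INF b\<in>B. N (y - b))"

definition haus :: "(real ^ 'd \<Rightarrow> real) \<Rightarrow> (real ^ 'd) set \<Rightarrow> (real ^ 'd) set \<Rightarrow> real" where
  "haus N A B = max (SUP p\<in>A. dist_set N p B) (SUP q\<in>B. dist_set N q A)"

definition set_norm :: "(real ^ 'd \<Rightarrow> real) \<Rightarrow> (real ^ 'd) set \<Rightarrow> real" where
  "set_norm N A = haus N A {0}"

definition proj_set :: "(real ^ 'd \<Rightarrow> real) \<Rightarrow> (real ^ 'd) set \<Rightarrow> real ^ 'd \<Rightarrow> (real ^ 'd) set" where
  "proj_set N B y = {b \<in> B. N (y - b) = dist_set N y B}"

definition metric_pairs ::
  "(real ^ 'd \<Rightarrow> real) \<Rightarrow> (real ^ 'd) set \<Rightarrow> (real ^ 'd) set \<Rightarrow> ((real ^ 'd) \<times> (real ^ 'd)) set" where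
  "metric_pairs N A B = {(p, q). p \<in> A \<and> q \<in> B \<and> (p \<in> proj_set N A q \<or> q \<in> proj_set N B p)}"

text \<open>
  A tuple \<open>(y\<^sub>0, \<dots>, y\<^sub>n)\<close> is represented by a function on \<open>nat\<close> of which only the values at
  \<open>0, \<dots>, n\<close> are relevant.  Membership \<open>y i \<in> A i\<close> follows from the metric pair condition
  if \<open>n \<ge> 1\<close>; for \<open>n = 0\<close> it makes the chains of a single set \<open>A\<^sub>0\<close> the elements of \<open>A\<^sub>0\<close>.
\<close>

definition metric_chains ::
  "(real ^ 'd \<Rightarrow> real) \<Rightarrow> nat \<Rightarrow> (nat \<Rightarrow> (real ^ 'd) set) \<Rightarrow> (nat \<Rightarrow> real ^ 'd) set" where
  "metric_chains N n A =
     {y. (\<forall>i\<le>n. y i \<in> A i) \<and> (\<forall>i<n. (y i, y (Suc i)) \<in> metric_pairs N (A i) (A (Suc i)))}"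

text \<open>
  \<open>is_partition a b n \<xi>\<close>: \<open>a = \<xi> 0 < \<dots> < \<xi> n = b\<close>.  The only partition of a
  one-point interval has \<open>n = 0\<close>, so the variation over such an interval is \<open>0\<close>.
\<close>

definition is_partition :: "real \<Rightarrow> real \<Rightarrow> nat \<Rightarrow> (nat \<Rightarrow> real) \<Rightarrow> bool" where
  "is_partition a b n \<xi> \<longleftrightarrow> \<xi> 0 = a \<and> \<xi> n = b \<and> (\<forall>i<n. \<xi> i < \<xi> (Suc i))"

definition mesh :: "nat \<Rightarrow> (nat \<Rightarrow> real) \<Rightarrow> real" where
  "mesh n \<xi> = Max ((\<lambda>i. \<xi> (Suc i) - \<xi> i) ` {..<n})"

text \<open>
  Variation of a function with values in a space with distance function \<open>\<rho>\<close>: below, \<open>\<rho>\<close> is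
  \<open>haus N\<close> for set-valued functions and \<open>dist\<close> for real-valued ones.
\<close>

definition variation :: "('c \<Rightarrow> 'c \<Rightarrow> real) \<Rightarrow> real \<Rightarrow> real \<Rightarrow> (real \<Rightarrow> 'c) \<Rightarrow> ereal" where
  "variation \<rho> a b f =
     Sup {ereal (\<Sum>i<n. \<rho> (f (\<xi> (Suc i))) (f (\<xi> i))) | n \<xi>. is_partition a b n \<xi>}"

definition bounded_variation :: "('c \<Rightarrow> 'c \<Rightarrow> real) \<Rightarrow> real \<Rightarrow> real \<Rightarrow> (real \<Rightarrow> 'c) \<Rightarrow> bool" where
  "bounded_variation \<rho> a b f \<longleftrightarrow> variation \<rho> a b f < \<infinity>"

definition variation_fun ::
  "(real ^ 'd \<Rightarrow> real) \<Rightarrow> real \<Rightarrow> (real \<Rightarrow> (real ^ 'd) set) \<Rightarrow> real \<Rightarrow> real" where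
  "variation_fun N a F x = real_of_ereal (variation (haus N) a x F)"

definition sup_norm ::
  "(real ^ 'd \<Rightarrow> real) \<Rightarrow> real \<Rightarrow> real \<Rightarrow> (real \<Rightarrow> (real ^ 'd) set) \<Rightarrow> real" where
  "sup_norm N a b F = (SUP x\<in>{a..b}. set_norm N (F x))"

definition svf_class ::
  "(real ^ 'd \<Rightarrow> real) \<Rightarrow> real \<Rightarrow> real \<Rightarrow> (real \<Rightarrow> (real ^ 'd) set) set" where
  "svf_class N a b =
     {F. (\<forall>x\<in>{a..b}. F x \<noteq> {} \<and> compact (F x)) \<and>
         bounded_variation (haus N) a b F \<and>
         compact {(x, y). x \<in> {a..b} \<and> y \<in> F x}}"

definition svf_continuous_at ::
  "(real ^ 'd \<Rightarrow> real) \<Rightarrow> real \<Rightarrow> real \<Rightarrow> (real \<Rightarrow> (real ^ 'd) set) \<Rightarrow> real \<Rightarrow> bool" where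
  "svf_continuous_at N a b F x \<longleftrightarrow> ((\<lambda>t. haus N (F t) (F x)) \<longlongrightarrow> 0) (at x within {a..b})"

definition local_modulus :: "real \<Rightarrow> real \<Rightarrow> (real \<Rightarrow> real) \<Rightarrow> real \<Rightarrow> real \<Rightarrow> real" where
  "local_modulus a b v x \<delta> =
     Sup {\<bar>v x1 - v x2\<bar> | x1 x2.
       x1 \<in> {x - \<delta>/2..x + \<delta>/2} \<inter> {a..b} \<and> x2 \<in> {x - \<delta>/2..x + \<delta>/2} \<inter> {a..b}}"

text \<open>In the next two definitions \<open>n \<ge> 1\<close> whenever \<open>\<xi>\<close> is a partition of \<open>[a,b]\<close> with \<open>a < b\<close>.\<close>

definition weighted_sums ::
  "(real ^ 'd \<Rightarrow> real) \<Rightarrow> (real \<Rightarrow> real) \<Rightarrow> (real \<Rightarrow> (real ^ 'd) set) \<Rightarrow> nat \<Rightarrow> (nat \<Rightarrow> real)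
     \<Rightarrow> (real ^ 'd) set" where
  "weighted_sums N \<kappa> F n \<xi> =
     {\<Sum>i<n. ((\<xi> (Suc i) - \<xi> i) * \<kappa> (\<xi> i)) *\<^sub>R y i | y.
        y \<in> metric_chains N (n - 1) (\<lambda>i. F (\<xi> i))}"

definition weighted_metric_integral ::
  "(real ^ 'd \<Rightarrow> real) \<Rightarrow> real \<Rightarrow> real \<Rightarrow> (real \<Rightarrow> real) \<Rightarrow> (real \<Rightarrow> (real ^ 'd) set)
     \<Rightarrow> (real ^ 'd) set" where
  "weighted_metric_integral N a b \<kappa> F =
     {z. \<exists>m \<xi> zs.
        (\<forall>k. is_partition a b (m k) (\<xi> k) \<and> zs k \<in> weighted_sums N \<kappa> F (m k) (\<xi> k)) \<and>
        (\<lambda>k. mesh (m k) (\<xi> k)) \<longlonglongrightarrow> 0 \<and> zs \<longlonglongrightarrow> z}"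

definition metric_operator ::
  "(real ^ 'd \<Rightarrow> real) \<Rightarrow> real \<Rightarrow> real \<Rightarrow> (nat \<Rightarrow> real \<Rightarrow> real \<Rightarrow> real) \<Rightarrow> nat
     \<Rightarrow> (real \<Rightarrow> (real ^ 'd) set) \<Rightarrow> real \<Rightarrow> (real ^ 'd) set" where
  "metric_operator N a b K n F x = weighted_metric_integral N a b (\<lambda>t. K n x t) F"

definition kernel_alpha ::
  "real \<Rightarrow> real \<Rightarrow> (nat \<Rightarrow> real \<Rightarrow> real \<Rightarrow> real) \<Rightarrow> nat \<Rightarrow> real \<Rightarrow> real" where
  "kernel_alpha a b K n x = \<bar>integral {a..b} (\<lambda>t. K n x t) - 1\<bar>"

definition kernel_beta ::
  "real \<Rightarrow> real \<Rightarrow> (nat \<Rightarrow> real \<Rightarrow> real \<Rightarrow> real) \<Rightarrow> nat \<Rightarrow> real \<Rightarrow> real \<Rightarrow> real" where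
  "kernel_beta a b K n x \<delta> = integral {t \<in> {a..b}. \<bar>x - t\<bar> \<ge> \<delta>} (\<lambda>t. \<bar>K n x t\<bar>)"

end

theory Submission
  imports Defs
begin

text \<open>
  The estimate is proved for the Riemann sums and survives the limit.  Along a metric chain
  \<open>y\<^sub>0, \<dots>, y\<^sub>n\<close> over a partition the triangle inequality gives
  \<open>|y\<^sub>i - y\<^sub>j| \<le> |v\<^sub>F(\<xi>\<^sub>i) - v\<^sub>F(\<xi>\<^sub>j)|\<close>.  If \<open>\<xi>\<^sub>j\<close> is near \<open>x\<close>, the weighted sum therefore differs from
  \<open>y\<^sub>j\<close> by the modulus of \<open>v\<^sub>F\<close> times the sum of \<open>|\<kappa>|\<close> near \<open>x\<close>, by \<open>2\<parallel>F\<parallel>\<close> times the sum of \<open>|\<kappa>|\<close>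
  away from \<open>x\<close>, and by \<open>\<parallel>F\<parallel>\<close> times the defect of the sum of \<open>\<kappa>\<close> from \<open>1\<close>; these sums converge to the
  integrals since \<open>\<kappa>\<close> has bounded variation.  For a point \<open>z\<close> of the integral, compactness of the graph
  makes \<open>y\<^sub>j\<close> accumulate at a point of \<open>F(x)\<close>; for a point \<open>w\<close> of \<open>F(x)\<close>, chains through \<open>w\<close>
  have bounded sums, which accumulate at a point of the integral.  No metric selections are needed.
  The limit statements follow because \<open>v\<^sub>F\<close> is continuous wherever \<open>F\<close> is; the pointwise one is the
  uniform one on the interval \<open>[x,x]\<close>.
\<close>

section \<open>Partitions\<close>

lemma partition_less:
  assumes "is_partition a b n \<xi>" "i < j" "j \<le> n"
  shows "\<xi> i < \<xi> j"
  using assms(2,3)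
proof (induction j)
  case (Suc j)
  have "\<xi> j < \<xi> (Suc j)" using assms(1) Suc.prems by (simp add: is_partition_def)
  then show ?case using Suc by (cases "i = j") auto
qed simp

lemma partition_le:
  assumes "is_partition a b n \<xi>" "i \<le> j" "j \<le> n"
  shows "\<xi> i \<le> \<xi> j"
  using partition_less[OF assms(1), of i j] assms(2,3) by (cases "i = j") auto

lemma partition_mem:
  assumes "is_partition a b n \<xi>" "i \<le> n"
  shows "\<xi> i \<in> {a..b}"
  using partition_le[OF assms(1), of 0 i] partition_le[OF assms(1), of i n] assms
  by (auto simp: is_partition_def)

text \<open>The first node beyond \<open>x\<close> ends the cell and its predecessor starts it. The
  cells are half-open, so \<open>x = b\<close> lies in none of them.\<close>

lemma partition_cell:
  assumes "is_partition a b n \<xi>" "a \<le> x" "x < b"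
  obtains i where "i < n" "\<xi> i \<le> x" "x < \<xi> (Suc i)"
proof -
  define k where "k = (LEAST k. x < \<xi> k)"
  have xn: "x < \<xi> n" using assms by (simp add: is_partition_def)
  have k: "x < \<xi> k" unfolding k_def using xn by (rule LeastI)
  have "k \<le> n" unfolding k_def using xn by (rule Least_le)
  have "k \<noteq> 0" using k assms by (auto simp: is_partition_def intro: ccontr)
  then obtain i where i: "k = Suc i" using not0_implies_Suc by blast
  have "\<not> x < \<xi> i" using not_less_Least[of i "\<lambda>k. x < \<xi> k"] i by (simp add: k_def)
  then show ?thesis using that[of i] i k \<open>k \<le> n\<close> by simp
qed

lemma mesh_ge: "i < n \<Longrightarrow> \<xi> (Suc i) - \<xi> i \<le> mesh n \<xi>"
  unfolding mesh_def by (rule Max_ge) auto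

text \<open>The junction \<open>b\<close> is read from \<open>\<xi>\<close> at index
  \<open>n\<close>; \<open>\<zeta>\<close> contributes only its indices from 1 on.\<close>

lemma partition_append:
  assumes "is_partition a b n \<xi>" "is_partition b c m \<zeta>"
  shows "is_partition a c (n + m) (\<lambda>i. if i \<le> n then \<xi> i else \<zeta> (i - n))"
proof -
  have "(if i \<le> n then \<xi> i else \<zeta> (i - n)) < (if Suc i \<le> n then \<xi> (Suc i) else \<zeta> (Suc i - n))"
    if "i < n + m" for i
  proof -
    consider "i < n" | "i = n" | "i > n" by linarith
    then show ?thesis
    proof cases
      case 3
      then have "\<zeta> (i - n) < \<zeta> (Suc (i - n))" using assms that by (simp add: is_partition_def)
      then show ?thesis using 3 by (simp add: Suc_diff_le)
    next
      case 2
      then have "0 < m" using that by simp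
      then have "\<zeta> 0 < \<zeta> (Suc 0)" using assms(2) unfolding is_partition_def by blast
      then show ?thesis using assms 2 by (simp add: is_partition_def)
    qed (use assms in \<open>auto simp: is_partition_def\<close>)
  qed
  then show ?thesis using assms by (auto simp: is_partition_def)
qed

lemma fine_partition_exists:
  assumes "a \<le> b" "0 < e"
  obtains n \<xi> where "is_partition a b n \<xi>" "\<And>i. i < n \<Longrightarrow> \<xi> (Suc i) - \<xi> i < e"
proof (cases "a = b")
  case True
  then show ?thesis using that[of 0 "\<lambda>_. a"] by (simp add: is_partition_def)
next
  case False
  \<comment> \<open>The successor makes \<open>n\<close> nonzero and strictly larger than
    \<open>(b - a) / e\<close>, so equal cells are strictly shorter than \<open>e\<close>.\<close>
  define n where "n = Suc (nat \<lceil>(b - a) / e\<rceil>)"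
  define \<xi> where "\<xi> i = a + real i * ((b - a) / n)" for i :: nat
  have "(b - a) / e < n" unfolding n_def by linarith
  then have "(b - a) / n < e" using assms(2) by (simp add: n_def field_simps)
  moreover have "\<xi> (Suc i) - \<xi> i = (b - a) / n" for i
    by (simp add: \<xi>_def distrib_right del: times_divide_eq_right)
  moreover have "(b - a) / n > 0" using assms(1) False by (intro divide_pos_pos) (simp_all add: n_def del: of_nat_Suc)
  moreover have "\<xi> 0 = a" "\<xi> n = b" by (simp_all add: \<xi>_def n_def)
  moreover have "is_partition a b n \<xi>"
    unfolding is_partition_def by (metis calculation(2-5) diff_gt_0_iff_gt)
  ultimately show ?thesis using that[of n \<xi>] by simp
qed

text \<open>Fine partitions of \<open>[a,x]\<close> and \<open>[x,b]\<close> are joined, and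
  \<open>x\<close> becomes the node of index \<open>n\<close>. One of the two has no cells if
  \<open>x\<close> is an endpoint.\<close>

lemma fine_partition_through_exists:
  assumes "x \<in> {a..b}" "0 < e"
  obtains n \<xi> j where "is_partition a b n \<xi>" "\<And>i. i < n \<Longrightarrow> \<xi> (Suc i) - \<xi> i < e"
    "j \<le> n" "\<xi> j = x"
proof -
  obtain n \<xi> where 1: "is_partition a x n \<xi>" "\<And>i. i < n \<Longrightarrow> \<xi> (Suc i) - \<xi> i < e"
    using fine_partition_exists[of a x e] assms by auto
  obtain m \<zeta> where 2: "is_partition x b m \<zeta>" "\<And>i. i < m \<Longrightarrow> \<zeta> (Suc i) - \<zeta> i < e"
    using fine_partition_exists[of x b e] assms by auto
  have "(if Suc i \<le> n then \<xi> (Suc i) else \<zeta> (Suc i - n)) - (if i \<le> n then \<xi> i else \<zeta> (i - n)) < e"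
    if "i < n + m" for i
  proof -
    consider "i < n" | "i = n" | "i > n" by linarith
    then show ?thesis
    proof cases
      case 3
      then have "\<zeta> (Suc (i - n)) - \<zeta> (i - n) < e" using 2 that by simp
      then show ?thesis using 3 by (simp add: Suc_diff_le)
    next
      case 2
      then have "\<zeta> (Suc 0) - \<zeta> 0 < e" using \<open>\<And>i. i < m \<Longrightarrow> \<zeta> (Suc i) - \<zeta> i < e\<close> that by simp
      then show ?thesis using 1(1) \<open>is_partition x b m \<zeta>\<close> 2 by (simp add: is_partition_def)
    qed (use 1 in auto)
  qed
  then show ?thesis
    using that[OF partition_append[OF 1(1) 2(1)], of n] 1(1) by (simp add: is_partition_def)
qed

section \<open>Variation\<close>

lemma partition_sum_le_variation:
  assumes "is_partition a b n \<xi>"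
  shows "ereal (\<Sum>i<n. \<rho> (f (\<xi> (Suc i))) (f (\<xi> i))) \<le> variation \<rho> a b f"
  unfolding variation_def using assms by (intro Sup_upper) auto

text \<open>Appending the node \<open>t\<close> to a partition of \<open>[a,s]\<close> adds exactly
  \<open>\<rho> (f t) (f s)\<close> to its sum. The increment is moved to the right-hand side first,
  so that the bound on each sum passes to the supremum.\<close>

lemma variation_snoc:
  assumes "s < t"
  shows "variation \<rho> a s f + ereal (\<rho> (f t) (f s)) \<le> variation \<rho> a t f"
proof -
  have "variation \<rho> a s f \<le> variation \<rho> a t f - ereal (\<rho> (f t) (f s))"
    unfolding variation_def[of \<rho> a s]
  proof (rule Sup_least, clarify)
    fix n \<xi> assume p: "is_partition a s n \<xi>"
    let ?\<zeta> = "\<xi>(Suc n := t)"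
    have q: "is_partition a t (Suc n) ?\<zeta>"
      using p assms by (auto simp: is_partition_def less_Suc_eq)
    have "(\<Sum>i<Suc n. \<rho> (f (?\<zeta> (Suc i))) (f (?\<zeta> i)))
        = (\<Sum>i<n. \<rho> (f (\<xi> (Suc i))) (f (\<xi> i))) + \<rho> (f t) (f s)"
      using p by (simp add: is_partition_def)
    moreover have "ereal (\<Sum>i<Suc n. \<rho> (f (?\<zeta> (Suc i))) (f (?\<zeta> i))) \<le> variation \<rho> a t f"
      by (rule partition_sum_le_variation[OF q])
    ultimately show "ereal (\<Sum>i<n. \<rho> (f (\<xi> (Suc i))) (f (\<xi> i)))
        \<le> variation \<rho> a t f - ereal (\<rho> (f t) (f s))"
      by (simp add: ereal_le_minus)
  qed
  then show ?thesis by (simp add: ereal_le_minus)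
qed

text \<open>Nonnegativity of \<open>\<rho>\<close> is only available on the values of \<open>f\<close>: \<open>haus\<close> is a junk value on, say, unbounded sets.\<close>

lemma variation_finite:
  assumes "bounded_variation \<rho> a b f" "t \<in> {a..b}"
    and nonneg: "\<And>s t. s \<in> {a..b} \<Longrightarrow> t \<in> {a..b} \<Longrightarrow> 0 \<le> \<rho> (f t) (f s)"
  shows "\<bar>variation \<rho> a t f\<bar> \<noteq> \<infinity>"
proof -
  obtain n \<xi> where p: "is_partition a t n \<xi>" 
    by (rule fine_partition_exists[of a t 1]) (use assms(2) in auto)
  have "0 \<le> (\<Sum>i<n. \<rho> (f (\<xi> (Suc i))) (f (\<xi> i)))"
  proof (intro sum_nonneg nonneg)
    fix i assume "i \<in> {..<n}"
    then show "\<xi> (Suc i) \<in> {a..b}" "\<xi> i \<in> {a..b}"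
      using partition_mem[OF p, of i] partition_mem[OF p, of "Suc i"] assms(2) by auto
  qed
  moreover have "ereal (\<Sum>i<n. \<rho> (f (\<xi> (Suc i))) (f (\<xi> i))) \<le> variation \<rho> a t f"
    by (rule partition_sum_le_variation[OF p])
  ultimately have "0 \<le> variation \<rho> a t f"
    by (metis ereal_less_eq(5) order_trans)
  moreover have "variation \<rho> a t f \<le> variation \<rho> a b f"
  proof (cases "t = b")
    case False
    then have "variation \<rho> a t f + 0 \<le> variation \<rho> a t f + ereal (\<rho> (f b) (f t))"
      using nonneg[of t b] assms(2) by (intro add_left_mono) simp
    also have "\<dots> \<le> variation \<rho> a b f" using False assms(2) by (intro variation_snoc) simp
    finally show ?thesis by simp
  qed simp
  moreover have "variation \<rho> a b f < \<infinity>" using assms(1) by (simp add: bounded_variation_def)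
  ultimately show ?thesis by auto
qed

lemma variation_increment:
  assumes "bounded_variation \<rho> a b f" "a \<le> s" "s < t" "t \<le> b"
    and nonneg: "\<And>s t. s \<in> {a..b} \<Longrightarrow> t \<in> {a..b} \<Longrightarrow> 0 \<le> \<rho> (f t) (f s)"
  shows "\<rho> (f t) (f s) \<le> real_of_ereal (variation \<rho> a t f) - real_of_ereal (variation \<rho> a s f)"
proof -
  obtain p q where "variation \<rho> a t f = ereal p" "variation \<rho> a s f = ereal q"
    using variation_finite[OF assms(1) _ nonneg, of t] variation_finite[OF assms(1) _ nonneg, of s]
      assms by auto
  then show ?thesis using variation_snoc[OF assms(3), of \<rho> a f] by simp
qed

text \<open>
  A partition whose sum is almost the total variation leaves no room for \<open>v\<close> to jump inside one of
  its cells by more than \<open>\<rho>\<close> does.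
\<close>

lemma variation_continuous:
  fixes \<rho> :: "'c \<Rightarrow> 'c \<Rightarrow> real" and f :: "real \<Rightarrow> 'c" and a :: real
  defines "v \<equiv> \<lambda>t. real_of_ereal (variation \<rho> a t f)"
  assumes bv: "bounded_variation \<rho> a b f" and x: "x \<in> {a..b}"
    and nonneg: "\<And>s t. s \<in> {a..b} \<Longrightarrow> t \<in> {a..b} \<Longrightarrow> 0 \<le> \<rho> (f t) (f s)"
    and sym: "\<And>s t. s \<in> {a..b} \<Longrightarrow> t \<in> {a..b} \<Longrightarrow> \<rho> (f t) (f s) = \<rho> (f s) (f t)"
    and refl: "\<And>t. t \<in> {a..b} \<Longrightarrow> \<rho> (f t) (f t) = 0"
    and triangle: "\<And>r s t. r \<in> {a..b} \<Longrightarrow> s \<in> {a..b} \<Longrightarrow> t \<in> {a..b} \<Longrightarrow>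
        \<rho> (f t) (f r) \<le> \<rho> (f t) (f s) + \<rho> (f s) (f r)"
    and cont: "((\<lambda>t. \<rho> (f t) (f x)) \<longlongrightarrow> 0) (at x within {a..b})"
  shows "(v \<longlongrightarrow> v x) (at x within {a..b})"
proof (rule tendstoI)
  fix e :: real assume "0 < e"
  have inc: "\<rho> (f t) (f s) \<le> v t - v s" if "s \<in> {a..b}" "t \<in> {a..b}" "s \<le> t" for s t
    using variation_increment[OF bv _ _ _ nonneg, of s t] refl that by (cases "s = t") (auto simp: v_def)
  have "a \<in> {a..b}" "b \<in> {a..b}" using x by auto
  \<comment> \<open>The partition of \<open>[a,a]\<close> without cells has sum 0. Nonnegativity
    allows \<open>v a\<close> to be dropped after telescoping.\<close>
  have va: "v a \<ge> 0"
  proof -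
    have "is_partition a a 0 (\<lambda>_. a)" by (simp add: is_partition_def)
    then have "ereal (\<Sum>i<0::nat. \<rho> (f a) (f a)) \<le> variation \<rho> a a f"
      by (rule partition_sum_le_variation)
    then show ?thesis unfolding v_def by (intro real_of_ereal_pos) (simp add: zero_ereal_def)
  qed
  have "ereal (v b) = variation \<rho> a b f"
    using variation_finite[OF bv \<open>b \<in> {a..b}\<close> nonneg] by (simp add: v_def ereal_real)
  then have "ereal (v b - e / 2) < variation \<rho> a b f" using \<open>0 < e\<close> by (metis diff_less_eq ereal_less_eq(3) half_gt_zero less_add_same_cancel1 linorder_not_less)
  then obtain n \<xi> where p: "is_partition a b n \<xi>"
    and big: "v b - e / 2 < (\<Sum>i<n. \<rho> (f (\<xi> (Suc i))) (f (\<xi> i)))"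
    unfolding variation_def less_Sup_iff by auto
  have cell: "v t - v s < e / 2 + \<rho> (f t) (f s)"
    if j: "j < n" "\<xi> j \<le> s" "s < t" "t \<le> \<xi> (Suc j)" for j s t
  proof -
    have mem: "\<xi> j \<in> {a..b}" "\<xi> (Suc j) \<in> {a..b}" using partition_mem[OF p] j by auto
    then have st: "s \<in> {a..b}" "t \<in> {a..b}" using j by auto
    \<comment> \<open>\<open>d\<close> is the excess of the increment of \<open>v\<close> over
      \<open>\<rho>\<close> on \<open>[s,t]\<close>. The sum over the partition misses at least
      \<open>d\<close>, yet misses less than \<open>e / 2\<close>.\<close>
    define d where "d = v t - v s - \<rho> (f t) (f s)"
    have "\<rho> (f (\<xi> (Suc j))) (f (\<xi> j)) \<le> v (\<xi> (Suc j)) - v (\<xi> j) - d"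
      using triangle[OF mem(1) st(2) mem(2)] triangle[OF mem(1) st(1) st(2)]
        inc[OF mem(1) st(1)] inc[OF st(2) mem(2)] j by (simp add: d_def)
    moreover have "\<rho> (f (\<xi> (Suc i))) (f (\<xi> i)) \<le> v (\<xi> (Suc i)) - v (\<xi> i)" if "i < n" for i
      using that partition_mem[OF p] partition_le[OF p] by (intro inc) auto
    ultimately have "(\<Sum>i<n. \<rho> (f (\<xi> (Suc i))) (f (\<xi> i)))
        \<le> (\<Sum>i<n. v (\<xi> (Suc i)) - v (\<xi> i) - (if i = j then d else 0))"
      by (intro sum_mono) auto
    also have "\<dots> = v (\<xi> n) - v (\<xi> 0) - d"
      using j by (subst sum_subtractf) (simp add: sum_lessThan_telescope[of "\<lambda>i. v (\<xi> i)"])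
    also have "\<dots> = v b - v a - d" using p by (simp add: is_partition_def)
    finally show ?thesis using big va by (simp add: d_def)
  qed
  \<comment> \<open>Nodes other than \<open>x\<close> keep distance \<open>r\<close> from
    \<open>x\<close>, so a point closer than \<open>r\<close> shares a closed cell with
    \<open>x\<close>. Inserting 1 gives the minimum a nonempty set.\<close>
  obtain r where r: "r > 0" "\<And>i. i \<le> n \<Longrightarrow> \<xi> i \<noteq> x \<Longrightarrow> r \<le> \<bar>\<xi> i - x\<bar>"
  proof -
    let ?S = "(\<lambda>i. \<bar>\<xi> i - x\<bar>) ` {i. i \<le> n \<and> \<xi> i \<noteq> x}"
    show thesis
      by (rule that[of "Min (insert 1 ?S)"]) auto
  qed
  have close: "\<bar>v t - v x\<bar> < e / 2 + \<rho> (f t) (f x)" if t: "t \<in> {a..b}" "t \<noteq> x" "\<bar>t - x\<bar> < r" for t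
  proof (cases "x < t")
    case True
    then obtain i where i: "i < n" "\<xi> i \<le> x" "x < \<xi> (Suc i)" using partition_cell[OF p, of x] x t by auto
    then have "t \<le> \<xi> (Suc i)" using r(2)[of "Suc i"] t by auto
    moreover have "v x \<le> v t" using inc[of x t] nonneg[of x t] True t x by auto
    ultimately show ?thesis using cell[OF i(1,2) True] by simp
  next
    case False
    then have "t < x" using t by simp
    \<comment> \<open>The cell is located from its left point \<open>t\<close>; here
      \<open>x\<close> may be the right end of the cell.\<close>
    then obtain i where i: "i < n" "\<xi> i \<le> t" "t < \<xi> (Suc i)" using partition_cell[OF p, of t] x t by auto
    then have "x \<le> \<xi> (Suc i)" using r(2)[of "Suc i"] t \<open>t < x\<close> by force
    moreover have "v t \<le> v x" using inc[of t x] nonneg[of t x] \<open>t < x\<close> t x by auto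
    ultimately show ?thesis using cell[OF i(1,2) \<open>t < x\<close>] sym[OF x t(1)] by simp
  qed
  have "\<forall>\<^sub>F t in at x within {a..b}. \<bar>\<rho> (f t) (f x)\<bar> < e / 2"
    using tendstoD[OF cont, of "e / 2"] \<open>0 < e\<close> by (simp add: dist_real_def)
  moreover have "\<forall>\<^sub>F t in at x within {a..b}. t \<in> {a..b} \<and> t \<noteq> x \<and> \<bar>t - x\<bar> < r"
    using r(1) by (auto simp: eventually_at dist_real_def)
  ultimately show "\<forall>\<^sub>F t in at x within {a..b}. dist (v t) (v x) < e"
  proof eventually_elim
    case (elim t)
    then show ?case using close[of t] by (simp add: dist_real_def)
  qed
qed

section \<open>Riemann sums of functions of bounded variation\<close>

definition riemann_sum :: "(real \<Rightarrow> real) \<Rightarrow> nat \<Rightarrow> (nat \<Rightarrow> real) \<Rightarrow> real" where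
  "riemann_sum f n \<xi> = (\<Sum>i<n. (\<xi> (Suc i) - \<xi> i) * f (\<xi> i))"

text \<open>Equivalently, \<open>v - f\<close> and \<open>v + f\<close> are nondecreasing on
  \<open>[a,b]\<close>. Such a bound passes to \<open>\<bar>f\<bar>\<close> with the same
  \<open>v\<close>, and to a truncation by adding jumps to \<open>v\<close>, without a new supremum
  over partitions.\<close>

definition increment_dominated :: "real \<Rightarrow> real \<Rightarrow> (real \<Rightarrow> real) \<Rightarrow> (real \<Rightarrow> real) \<Rightarrow> bool" where
  "increment_dominated a b f v \<longleftrightarrow> (\<forall>s t. a \<le> s \<longrightarrow> s \<le> t \<longrightarrow> t \<le> b \<longrightarrow> \<bar>f t - f s\<bar> \<le> v t - v s)"

lemma increment_dominatedD:
  "increment_dominated a b f v \<Longrightarrow> a \<le> s \<Longrightarrow> s \<le> t \<Longrightarrow> t \<le> b \<Longrightarrow> \<bar>f t - f s\<bar> \<le> v t - v s"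
  by (simp add: increment_dominated_def)

lemma bounded_variation_dominated:
  assumes "bounded_variation dist a b f"
  obtains v where "increment_dominated a b f v"
proof
  show "increment_dominated a b f (\<lambda>t. real_of_ereal (variation dist a t f))"
    unfolding increment_dominated_def
  proof (intro allI impI)
    fix s t assume "a \<le> s" "s \<le> t" "t \<le> b"
    then show "\<bar>f t - f s\<bar> \<le> real_of_ereal (variation dist a t f) - real_of_ereal (variation dist a s f)"
      using variation_increment[OF assms, of s t] by (cases "s = t") (auto simp: dist_real_def)
  qed
qed

text \<open>\<open>f\<close> is the difference of the nondecreasing functions \<open>v\<close> and
  \<open>v - f\<close>.\<close>

lemma increment_dominated_integrable:
  assumes "increment_dominated a b f v"
  shows "f integrable_on {a..b}"
proof -
  have *: "v s \<le> v t" "v s - f s \<le> v t - f t" if "a \<le> s" "s \<le> t" "t \<le> b" for s t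
    using increment_dominatedD[OF assms that] by auto
  have "v integrable_on {a..b}" "(\<lambda>t. v t - f t) integrable_on {a..b}"
    by (intro integrable_on_mono_on mono_onI; use * in force)+
  then have "(\<lambda>t. v t - (v t - f t)) integrable_on {a..b}" by (rule integrable_diff)
  then show ?thesis by simp
qed

lemma increment_dominated_abs:
  "increment_dominated a b f v \<Longrightarrow> increment_dominated a b (\<lambda>t. \<bar>f t\<bar>) v"
  unfolding increment_dominated_def by (meson abs_triangle_ineq3 order_trans)

text \<open>Truncating \<open>\<bar>f\<bar>\<close> near \<open>x\<close> creates at most two jumps,
  each no larger than a bound \<open>C\<close> of \<open>\<bar>f\<bar>\<close>. They are paid for by
  adding \<open>C\<close> to the dominating function at each jump.\<close>

lemma increment_dominated_far:
  assumes "increment_dominated a b f v"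
  obtains w where "increment_dominated a b (\<lambda>t. if \<delta> \<le> \<bar>x - t\<bar> then \<bar>f t\<bar> else 0) w"
proof
  define C where "C = \<bar>f a\<bar> + (v b - v a)"
  \<comment> \<open>\<open>u\<close> counts the ends of the near zone that have been passed. The far
    set is closed, so it is left just after \<open>x - \<delta>\<close> and entered again at
    \<open>x + \<delta>\<close>: one inequality is strict, the other is not.\<close>
  define u :: "real \<Rightarrow> real" where "u t = (if x - \<delta> < t then 1 else 0) + (if x + \<delta> \<le> t then 1 else 0)" for t
  have C: "\<bar>f t\<bar> \<le> C" if "a \<le> t" "t \<le> b" for t
    using increment_dominatedD[OF assms, of a t] increment_dominatedD[OF assms, of t b] that
    by (simp add: C_def)
  show "increment_dominated a b (\<lambda>t. if \<delta> \<le> \<bar>x - t\<bar> then \<bar>f t\<bar> else 0) (\<lambda>t. v t + C * u t)"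
    unfolding increment_dominated_def
  proof (intro allI impI)
    fix s t assume st: "a \<le> s" "s \<le> t" "t \<le> b"
    let ?g = "\<lambda>t. if \<delta> \<le> \<bar>x - t\<bar> then \<bar>f t\<bar> else 0"
    have d: "\<bar>\<bar>f t\<bar> - \<bar>f s\<bar>\<bar> \<le> v t - v s"
      using increment_dominatedD[OF increment_dominated_abs[OF assms] st] .
    have "\<bar>f s\<bar> \<le> C" "\<bar>f t\<bar> \<le> C" using C st by auto
    have cases: "\<bar>?g t - ?g s\<bar> \<le> \<bar>\<bar>f t\<bar> - \<bar>f s\<bar>\<bar> \<or> \<bar>?g t - ?g s\<bar> \<le> C \<and> 1 \<le> u t - u s"
    proof (cases "(\<delta> \<le> \<bar>x - t\<bar>) = (\<delta> \<le> \<bar>x - s\<bar>)")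
      case False
      then have "1 \<le> u t - u s" using st(2) by (auto simp: u_def)
      moreover have "\<bar>?g t - ?g s\<bar> \<le> C" using False \<open>\<bar>f s\<bar> \<le> C\<close> \<open>\<bar>f t\<bar> \<le> C\<close> by auto
      ultimately show ?thesis by blast
    qed auto
    have "u s \<le> u t" using st by (auto simp: u_def)
    have "0 \<le> C" using \<open>\<bar>f s\<bar> \<le> C\<close> by linarith
    have "C \<le> C * (u t - u s)" if "1 \<le> u t - u s"
      using mult_left_mono[OF that \<open>0 \<le> C\<close>] by simp
    moreover have "0 \<le> C * (u t - u s)" using \<open>u s \<le> u t\<close> \<open>0 \<le> C\<close> by simp
    moreover have "y \<le> (v t - v s) + z"
      if "y \<le> \<bar>\<bar>f t\<bar> - \<bar>f s\<bar>\<bar> \<or> y \<le> C \<and> C \<le> z" "0 \<le> z" for y z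
      using that d by linarith
    ultimately have "\<bar>?g t - ?g s\<bar> \<le> (v t - v s) + C * (u t - u s)"
      using cases by blast
    then show "\<bar>?g t - ?g s\<bar> \<le> v t + C * u t - (v s + C * u s)"
      by (simp add: right_diff_distrib)
  qed
qed

text \<open>Within a cell, \<open>f\<close> differs from its value at the left end by at most the
  increment of \<open>v\<close> there. The error of the cell is at most the mesh times this
  increment, and the increments telescope.\<close>

lemma riemann_sum_error:
  assumes dom: "increment_dominated a b f v" and p: "is_partition a b n \<xi>"
  shows "\<bar>riemann_sum f n \<xi> - integral {a..b} f\<bar> \<le> mesh n \<xi> * (v b - v a)"
proof -
  have int: "f integrable_on {s..t}" if "a \<le> s" "t \<le> b" for s t
    using increment_dominated_integrable[OF dom] by (rule integrable_on_subinterval) (use that in auto)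
  have split: "integral {a..\<xi> k} f = (\<Sum>i<k. integral {\<xi> i..\<xi> (Suc i)} f)" if "k \<le> n" for k
    using that
  proof (induction k)
    case 0
    then show ?case using p by (simp add: is_partition_def)
  next
    case (Suc k)
    have "integral {a..\<xi> k} f + integral {\<xi> k..\<xi> (Suc k)} f = integral {a..\<xi> (Suc k)} f"
      using partition_mem[OF p, of k] partition_mem[OF p, of "Suc k"] partition_le[OF p, of k "Suc k"] Suc.prems
      by (intro Henstock_Kurzweil_Integration.integral_combine int) auto
    then show ?case using Suc by simp
  qed
  have cell: "\<bar>(\<xi> (Suc i) - \<xi> i) * f (\<xi> i) - integral {\<xi> i..\<xi> (Suc i)} f\<bar>
      \<le> mesh n \<xi> * (v (\<xi> (Suc i)) - v (\<xi> i))" if "i < n" for i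
  proof -
    have mem: "a \<le> \<xi> i" "\<xi> (Suc i) \<le> b" and le: "\<xi> i \<le> \<xi> (Suc i)"
      using partition_mem[OF p, of i] partition_mem[OF p, of "Suc i"] partition_le[OF p, of i "Suc i"] that by auto
    let ?D = "v (\<xi> (Suc i)) - v (\<xi> i)"
    have "integral {\<xi> i..\<xi> (Suc i)} (\<lambda>t. f t - f (\<xi> i))
        = integral {\<xi> i..\<xi> (Suc i)} f - (\<xi> (Suc i) - \<xi> i) * f (\<xi> i)"
      using int[OF mem] le by (subst Henstock_Kurzweil_Integration.integral_diff) auto
    moreover have "norm (integral {\<xi> i..\<xi> (Suc i)} (\<lambda>t. f t - f (\<xi> i)))
        \<le> integral {\<xi> i..\<xi> (Suc i)} (\<lambda>_. ?D)"
    proof (rule Henstock_Kurzweil_Integration.integral_norm_bound_integral)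
      fix t assume "t \<in> {\<xi> i..\<xi> (Suc i)}"
      then show "norm (f t - f (\<xi> i)) \<le> ?D"
        using increment_dominatedD[OF dom, of "\<xi> i" t] increment_dominatedD[OF dom, of t "\<xi> (Suc i)"] mem by auto
    qed (use int[OF mem] in \<open>auto intro: integrable_diff\<close>)
    moreover have "integral {\<xi> i..\<xi> (Suc i)} (\<lambda>_. ?D) = ?D * (\<xi> (Suc i) - \<xi> i)"
      using le by simp
    moreover have "?D * (\<xi> (Suc i) - \<xi> i) \<le> ?D * mesh n \<xi>"
      using increment_dominatedD[OF dom mem(1) le mem(2)] mesh_ge[OF that] by (intro mult_left_mono) auto
    ultimately show ?thesis using le by (simp add: mult.commute abs_minus_commute)
  qed
  have "riemann_sum f n \<xi> - integral {a..b} f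
      = (\<Sum>i<n. (\<xi> (Suc i) - \<xi> i) * f (\<xi> i) - integral {\<xi> i..\<xi> (Suc i)} f)"
    using split[of n] p by (simp add: riemann_sum_def sum_subtractf is_partition_def)
  also have "\<bar>\<dots>\<bar> \<le> (\<Sum>i<n. mesh n \<xi> * (v (\<xi> (Suc i)) - v (\<xi> i)))"
    using cell by (intro order_trans[OF sum_abs] sum_mono) auto
  also have "\<dots> = mesh n \<xi> * (v b - v a)"
    using p by (simp add: sum_lessThan_telescope[of "\<lambda>i. v (\<xi> i)"] is_partition_def flip: sum_distrib_left)
  finally show ?thesis .
qed

lemma riemann_sum_tendsto:
  assumes "increment_dominated a b f v" "\<And>k. is_partition a b (m k) (\<xi> k)"
    and "(\<lambda>k. mesh (m k) (\<xi> k)) \<longlonglongrightarrow> 0"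
  shows "(\<lambda>k. riemann_sum f (m k) (\<xi> k)) \<longlonglongrightarrow> integral {a..b} f"
proof (rule LIM_zero_cancel, rule Lim_null_comparison)
  show "\<forall>\<^sub>F k in sequentially. norm (riemann_sum f (m k) (\<xi> k) - integral {a..b} f)
      \<le> mesh (m k) (\<xi> k) * (v b - v a)"
    using riemann_sum_error[OF assms(1,2)] by (intro always_eventually) simp
  show "(\<lambda>k. mesh (m k) (\<xi> k) * (v b - v a)) \<longlonglongrightarrow> 0"
    using tendsto_mult_left_zero[OF assms(3)] .
qed

section \<open>Hausdorff distance and metric chains\<close>

context
  fixes N :: "real ^ 'd \<Rightarrow> real"
  assumes N: "is_norm N"
begin

section \<open>Consequences of the norm axioms\<close>

lemma is_norm_scale: "N (r *\<^sub>R y) = \<bar>r\<bar> * N y"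
  and is_norm_triangle: "N (y + z) \<le> N y + N z"
  and is_norm_zero_iff: "N y = 0 \<longleftrightarrow> y = 0"
  using N by (auto simp: is_norm_def)

lemma is_norm_zero: "N 0 = 0"
  by (simp add: is_norm_zero_iff)

lemma is_norm_minus: "N (- y) = N y"
  using is_norm_scale[of "-1" y] by simp

lemma is_norm_commute: "N (y - z) = N (z - y)"
  using is_norm_minus[of "y - z"] by simp

lemma is_norm_triangle_through: "N (x - z) \<le> N (x - y) + N (y - z)"
  using is_norm_triangle[of "x - y" "y - z"] by simp

lemma is_norm_diff_le: "N (y - z) \<le> N y + N z"
  using is_norm_triangle[of y "- z"] is_norm_minus[of z] by simp

lemma is_norm_nonneg: "0 \<le> N y"
  using is_norm_diff_le[of y y] is_norm_zero by simp

lemma is_norm_sum_le: "N (\<Sum>i<n. f i) \<le> (\<Sum>i<n. N (f i))" for n :: nat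
  by (induction n) (auto simp: is_norm_zero intro: order_trans[OF is_norm_triangle])

text \<open>A norm is convex, and a finite convex function on a finite-dimensional space is
  continuous. This links \<open>N\<close> to the library's topology.\<close>

lemma is_norm_continuous: "continuous_on S N"
proof -
  have "convex_on UNIV N"
    using is_norm_scale is_norm_triangle by (intro convex_onI) (auto intro: order_trans[OF is_norm_triangle])
  then have "continuous_on UNIV N" by (intro convex_on_continuous) auto
  then show ?thesis by (rule continuous_on_subset) simp
qed

lemma is_norm_tendsto: "(f \<longlongrightarrow> l) G \<Longrightarrow> ((\<lambda>k. N (f k)) \<longlongrightarrow> N l) G"
  using continuous_on_tendsto_compose[OF is_norm_continuous[of UNIV]] by simp

section \<open>Distance to a set and projections\<close>

lemma bdd_below_norm: "bdd_below ((\<lambda>b. N (p - b)) ` B)"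
  by (rule bdd_belowI[of _ 0]) (auto simp: is_norm_nonneg)

lemma dist_set_le: "b \<in> B \<Longrightarrow> dist_set N p B \<le> N (p - b)"
  unfolding dist_set_def by (rule cINF_lower[OF bdd_below_norm])

lemma dist_set_nonneg: "B \<noteq> {} \<Longrightarrow> 0 \<le> dist_set N p B"
  unfolding dist_set_def by (rule cINF_greatest) (auto simp: is_norm_nonneg)

lemma proj_set_nonempty:
  assumes "compact B" "B \<noteq> {}"
  obtains b where "b \<in> proj_set N B p"
proof -
  have "continuous_on B (\<lambda>b. N (p - b))"
    by (rule continuous_on_compose2[OF is_norm_continuous[of UNIV]]) (auto intro: continuous_intros)
  then obtain b where b: "b \<in> B" "\<And>c. c \<in> B \<Longrightarrow> N (p - b) \<le> N (p - c)"
    using continuous_attains_inf[OF assms] by blast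
  then have "N (p - b) \<le> dist_set N p B"
    unfolding dist_set_def using assms(2) by (intro cINF_greatest) auto
  then show ?thesis using that[of b] b dist_set_le[of b B p] by (simp add: proj_set_def)
qed

text \<open>Makes the suprema in \<open>haus\<close> meaningful: the distance to \<open>B\<close> is
  at most the distance to one fixed point of \<open>B\<close>, which is bounded on the compact set
  \<open>A\<close>.\<close>

lemma bdd_above_dist_set:
  assumes "compact A" "B \<noteq> {}"
  shows "bdd_above ((\<lambda>p. dist_set N p B) ` A)"
proof -
  obtain b where b: "b \<in> B" using assms by blast
  have "continuous_on A (\<lambda>p. N (p - b))"
    by (rule continuous_on_compose2[OF is_norm_continuous[of UNIV]]) (auto intro: continuous_intros)
  then have "bdd_above ((\<lambda>p. N (p - b)) ` A)"
    using assms(1) by (intro bounded_imp_bdd_above compact_imp_bounded compact_continuous_image)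
  then obtain C where "\<And>p. p \<in> A \<Longrightarrow> N (p - b) \<le> C" by (auto simp: bdd_above_def)
  then show ?thesis
    using order_trans[OF dist_set_le[OF b]] by (intro bdd_aboveI2[where M = C]) blast
qed

section \<open>The Hausdorff distance\<close>

lemma haus_commute: "haus N A B = haus N B A"
  by (simp add: haus_def max.commute)

lemma dist_set_le_haus:
  assumes "compact A" "B \<noteq> {}" "p \<in> A"
  shows "dist_set N p B \<le> haus N A B"
  unfolding haus_def
  by (rule max.coboundedI1) (rule cSUP_upper[OF assms(3) bdd_above_dist_set[OF assms(1,2)]])

lemma haus_attained:
  assumes "compact A" "compact B" "B \<noteq> {}" "p \<in> A"
  obtains q where "q \<in> B" "N (p - q) \<le> haus N A B"
  using proj_set_nonempty[OF assms(2,3), of p] dist_set_le_haus[OF assms(1,3,4)]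
  unfolding proj_set_def by (metis (mono_tags, lifting) mem_Collect_eq)

text \<open>Approximation within \<open>r\<close> in both directions itself bounds the two suprema.
  In this form the lemma applies to a weighted metric integral, once that is known to be
  non-empty.\<close>

lemma haus_bounds:
  assumes "A \<noteq> {}" "B \<noteq> {}"
    and AB: "\<And>p. p \<in> A \<Longrightarrow> \<exists>q\<in>B. N (p - q) \<le> r" and BA: "\<And>q. q \<in> B \<Longrightarrow> \<exists>p\<in>A. N (q - p) \<le> r"
  shows "0 \<le> haus N A B" "haus N A B \<le> r"
proof -
  have 1: "dist_set N p B \<le> r" if "p \<in> A" for p
    using AB[OF that] dist_set_le by (meson order_trans)
  have 2: "dist_set N q A \<le> r" if "q \<in> B" for q
    using BA[OF that] dist_set_le by (meson order_trans)
  show "haus N A B \<le> r"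
    unfolding haus_def using assms(1,2) 1 2 by (intro max.boundedI cSUP_least) auto
  obtain p where "p \<in> A" using assms(1) by blast
  have "0 \<le> dist_set N p B" using dist_set_nonneg[OF assms(2)] .
  also have "\<dots> \<le> (SUP p\<in>A. dist_set N p B)"
    using 1 by (intro cSUP_upper[OF \<open>p \<in> A\<close>] bdd_aboveI2[where M = r])
  finally show "0 \<le> haus N A B" by (simp add: haus_def)
qed

lemma haus_triangle:
  assumes "compact A" "A \<noteq> {}" "compact B" "B \<noteq> {}" "compact C" "C \<noteq> {}"
  shows "haus N A C \<le> haus N A B + haus N B C"
proof (rule haus_bounds(2)[OF assms(2,6)])
  fix p assume "p \<in> A"
  obtain q where q: "q \<in> B" "N (p - q) \<le> haus N A B" by (rule haus_attained[OF assms(1,3,4) \<open>p \<in> A\<close>])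
  obtain r where r: "r \<in> C" "N (q - r) \<le> haus N B C" by (rule haus_attained[OF assms(3,5,6) q(1)])
  show "\<exists>r\<in>C. N (p - r) \<le> haus N A B + haus N B C"
    using q r is_norm_triangle_through[of p r q] by force
next
  fix r assume "r \<in> C"
  obtain q where q: "q \<in> B" "N (r - q) \<le> haus N C B" by (rule haus_attained[OF assms(5,3,4) \<open>r \<in> C\<close>])
  obtain p where p: "p \<in> A" "N (q - p) \<le> haus N B A" by (rule haus_attained[OF assms(3,1,2) q(1)])
  show "\<exists>p\<in>A. N (r - p) \<le> haus N A B + haus N B C"
    using p q is_norm_triangle_through[of r p q] haus_commute[of A B] haus_commute[of B C] by force
qed

lemma haus_nonneg:
  assumes "compact A" "A \<noteq> {}" "B \<noteq> {}"
  shows "0 \<le> haus N A B"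
  using assms dist_set_le_haus[OF assms(1,3)] dist_set_nonneg[OF assms(3)] by (meson ex_in_conv order_trans)

lemma haus_refl: "A \<noteq> {} \<Longrightarrow> haus N A A = 0"
  by (rule antisym; rule haus_bounds) (auto intro!: bexI simp: is_norm_zero)

section \<open>Metric pairs and metric chains\<close>

lemma metric_pairs_haus:
  assumes "compact A" "compact B" "(p, q) \<in> metric_pairs N A B"
  shows "N (p - q) \<le> haus N A B"
proof -
  consider "p \<in> A" "q \<in> B" "N (q - p) = dist_set N q A" | "p \<in> A" "q \<in> B" "N (p - q) = dist_set N p B"
    using assms(3) by (auto simp: metric_pairs_def proj_set_def)
  then show ?thesis
  proof cases
    case 1
    then show ?thesis
      using dist_set_le_haus[OF assms(2), of A q] by (auto simp: is_norm_commute haus_commute[of B A])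
  next
    case 2
    then show ?thesis using dist_set_le_haus[OF assms(1), of B p] by auto
  qed
qed

text \<open>The chain is built backwards: the predecessor of \<open>w\<close> is a point of
  \<open>A j\<close> nearest to \<open>w\<close>, and the induction hypothesis is applied to that
  point.\<close>

lemma metric_chain_to:
  assumes "\<And>i. i \<le> j \<Longrightarrow> compact (A i) \<and> A i \<noteq> {}" "w \<in> A j"
  shows "\<exists>y\<in>metric_chains N j A. y j = w"
  using assms
proof (induction j arbitrary: w)
  case 0
  then show ?case by (intro bexI[of _ "\<lambda>_. w"]) (auto simp: metric_chains_def)
next
  case (Suc j)
  obtain p where p: "p \<in> proj_set N (A j) w"
    using proj_set_nonempty[of "A j" w] Suc.prems(1)[of j] by auto
  then obtain y where "y \<in> metric_chains N j A" "y j = p"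
    using Suc by (force simp: proj_set_def)
  then show ?case
    using p Suc.prems(2)
    by (intro bexI[of _ "y(Suc j := w)"])
      (auto simp: metric_chains_def metric_pairs_def less_Suc_eq le_Suc_eq proj_set_def)
qed

text \<open>A chain ending in \<open>w\<close> is continued forwards, each time by a nearest point
  of the next set.\<close>

lemma metric_chain_through:
  assumes "\<And>i. i \<le> n \<Longrightarrow> compact (A i) \<and> A i \<noteq> {}" "j \<le> n" "w \<in> A j"
  shows "\<exists>y\<in>metric_chains N n A. y j = w"
  using assms(2,1)
proof (induction n rule: dec_induct)
  case base
  then show ?case using metric_chain_to[of j A w] assms(3) by simp
next
  case (step n)
  then obtain y where y: "y \<in> metric_chains N n A" "y j = w" by auto
  obtain q where q: "q \<in> proj_set N (A (Suc n)) (y n)"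
    using proj_set_nonempty[of "A (Suc n)" "y n"] step.prems[of "Suc n"] by auto
  then show ?case
    using y step.hyps
    by (intro bexI[of _ "y(Suc n := q)"])
      (auto simp: metric_chains_def metric_pairs_def less_Suc_eq le_Suc_eq proj_set_def)
qed

lemma metric_chains_restrict: "y \<in> metric_chains N n A \<Longrightarrow> m \<le> n \<Longrightarrow> y \<in> metric_chains N m A"
  by (auto simp: metric_chains_def)

text \<open>Uses \<open>\<Sum> D\<^sub>i \<kappa>\<^sub>i y\<^sub>i - w = \<Sum> D\<^sub>i \<kappa>\<^sub>i (y\<^sub>i - w) + (\<Sum> D\<^sub>i \<kappa>\<^sub>i - 1) w\<close>, where \<open>D\<^sub>i\<close> are the lengths of the cells.\<close>

lemma weighted_sum_estimate:
  fixes \<kappa> :: "real \<Rightarrow> real" and \<xi> :: "nat \<Rightarrow> real"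
  assumes inc: "\<And>i. i < n \<Longrightarrow> \<xi> i \<le> \<xi> (Suc i)"
    and S: "N w \<le> S" "\<And>i. i < n \<Longrightarrow> N (y i) \<le> S"
    and near: "0 \<le> \<omega>" "\<And>i. i < n \<Longrightarrow> \<bar>x - \<xi> i\<bar> < \<delta> \<Longrightarrow> N (y i - w) \<le> \<omega>"
  shows "N ((\<Sum>i<n. ((\<xi> (Suc i) - \<xi> i) * \<kappa> (\<xi> i)) *\<^sub>R y i) - w)
    \<le> \<omega> * riemann_sum (\<lambda>t. \<bar>\<kappa> t\<bar>) n \<xi>
      + S * (2 * riemann_sum (\<lambda>t. if \<delta> \<le> \<bar>x - t\<bar> then \<bar>\<kappa> t\<bar> else 0) n \<xi>
        + \<bar>riemann_sum \<kappa> n \<xi> - 1\<bar>)"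
proof -
  let ?D = "\<lambda>i. \<xi> (Suc i) - \<xi> i"
  let ?far = "\<lambda>t. if \<delta> \<le> \<bar>x - t\<bar> then \<bar>\<kappa> t\<bar> else 0"
  have "(\<Sum>i<n. (?D i * \<kappa> (\<xi> i)) *\<^sub>R y i) - w
      = (\<Sum>i<n. (?D i * \<kappa> (\<xi> i)) *\<^sub>R (y i - w)) + (riemann_sum \<kappa> n \<xi> - 1) *\<^sub>R w"
    by (simp add: riemann_sum_def scaleR_diff_right sum_subtractf scaleR_diff_left scaleR_left.sum)
  then have "N ((\<Sum>i<n. (?D i * \<kappa> (\<xi> i)) *\<^sub>R y i) - w)
      \<le> (\<Sum>i<n. N ((?D i * \<kappa> (\<xi> i)) *\<^sub>R (y i - w))) + N ((riemann_sum \<kappa> n \<xi> - 1) *\<^sub>R w)"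
    using order_trans[OF is_norm_triangle add_right_mono[OF is_norm_sum_le]] by simp
  also have "N ((riemann_sum \<kappa> n \<xi> - 1) *\<^sub>R w) \<le> S * \<bar>riemann_sum \<kappa> n \<xi> - 1\<bar>"
    using mult_left_mono[OF S(1), of "\<bar>riemann_sum \<kappa> n \<xi> - 1\<bar>"] by (simp add: is_norm_scale mult.commute)
  also have "(\<Sum>i<n. N ((?D i * \<kappa> (\<xi> i)) *\<^sub>R (y i - w)))
      \<le> (\<Sum>i<n. \<omega> * (?D i * \<bar>\<kappa> (\<xi> i)\<bar>) + 2 * S * (?D i * ?far (\<xi> i)))"
  proof (rule sum_mono)
    fix i assume "i \<in> {..<n}"
    then have i: "i < n" by simp
    then have D: "0 \<le> ?D i" using inc by simp
    have "N ((?D i * \<kappa> (\<xi> i)) *\<^sub>R (y i - w)) = ?D i * \<bar>\<kappa> (\<xi> i)\<bar> * N (y i - w)"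
      using D by (simp add: is_norm_scale abs_mult)
    also have "\<dots> \<le> \<omega> * (?D i * \<bar>\<kappa> (\<xi> i)\<bar>) + 2 * S * (?D i * ?far (\<xi> i))"
    proof (cases "\<delta> \<le> \<bar>x - \<xi> i\<bar>")
      case True
      \<comment> \<open>Two vectors of size at most \<open>S\<close> give the factor 2 of the far
        part. The \<omega>-sum runs over all cells, so at a far cell its term is merely
        nonnegative.\<close>
      have "N (y i - w) \<le> 2 * S" using is_norm_diff_le[of "y i" w] S(1) S(2)[OF i] by simp
      then have "?D i * \<bar>\<kappa> (\<xi> i)\<bar> * N (y i - w) \<le> ?D i * \<bar>\<kappa> (\<xi> i)\<bar> * (2 * S)"
        using D by (intro mult_left_mono) auto
      moreover have "0 \<le> \<omega> * (?D i * \<bar>\<kappa> (\<xi> i)\<bar>)" using near(1) D by simp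
      ultimately show ?thesis using True by (simp add: mult_ac)
    next
      case False
      then have "?D i * \<bar>\<kappa> (\<xi> i)\<bar> * N (y i - w) \<le> ?D i * \<bar>\<kappa> (\<xi> i)\<bar> * \<omega>"
        using D near(2)[OF i] by (intro mult_left_mono) auto
      then show ?thesis using False by (simp add: mult_ac)
    qed
    finally show "N ((?D i * \<kappa> (\<xi> i)) *\<^sub>R (y i - w))
        \<le> \<omega> * (?D i * \<bar>\<kappa> (\<xi> i)\<bar>) + 2 * S * (?D i * ?far (\<xi> i))" .
  qed
  also have "\<dots> = \<omega> * riemann_sum (\<lambda>t. \<bar>\<kappa> t\<bar>) n \<xi> + S * (2 * riemann_sum ?far n \<xi>)"
    unfolding riemann_sum_def sum.distrib sum_distrib_left[symmetric] by simp
  finally show ?thesis by (simp add: distrib_left)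
qed

end

section \<open>Weighted metric integrals\<close>

context
  fixes N :: "real ^ 'd \<Rightarrow> real" and a b :: real and F :: "real \<Rightarrow> (real ^ 'd) set"
  assumes N: "is_norm N" and ab: "a < b" and F: "F \<in> svf_class N a b"
begin

section \<open>Variation, modulus and norm bounds for a function of the class\<close>

lemma svf_value: "t \<in> {a..b} \<Longrightarrow> compact (F t) \<and> F t \<noteq> {}"
  using F by (auto simp: svf_class_def)

lemma svf_bounded_variation: "bounded_variation (haus N) a b F"
  using F by (auto simp: svf_class_def)

lemma svf_compact_graph: "compact {(x, y). x \<in> {a..b} \<and> y \<in> F x}"
  using F by (auto simp: svf_class_def)

lemma svf_haus_nonneg: "s \<in> {a..b} \<Longrightarrow> t \<in> {a..b} \<Longrightarrow> 0 \<le> haus N (F s) (F t)"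
  using haus_nonneg[OF N, of "F s" "F t"] svf_value[of s] svf_value[of t] by simp

lemma haus_le_variation_diff:
  assumes "a \<le> s" "s \<le> t" "t \<le> b"
  shows "haus N (F s) (F t) \<le> variation_fun N a F t - variation_fun N a F s"
proof (cases "s = t")
  case True
  then show ?thesis using haus_refl[OF N] svf_value[of t] assms by simp
next
  case False
  then show ?thesis
    using variation_increment[OF svf_bounded_variation _ _ _ svf_haus_nonneg, of s t] assms haus_commute[OF N]
    by (simp add: variation_fun_def)
qed

lemma variation_fun_mono:
  "a \<le> s \<Longrightarrow> s \<le> t \<Longrightarrow> t \<le> b \<Longrightarrow> variation_fun N a F s \<le> variation_fun N a F t"
  using haus_le_variation_diff[of s t] svf_haus_nonneg[of s t] by simp

lemma variation_fun_diff_le: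
  assumes "s \<in> {a..b}" "t \<in> {a..b}"
  shows "\<bar>variation_fun N a F s - variation_fun N a F t\<bar> \<le> variation_fun N a F b - variation_fun N a F a"
  using assms variation_fun_mono[of a s] variation_fun_mono[of a t] variation_fun_mono[of s b]
    variation_fun_mono[of t b] by auto

text \<open>The real supremum needs a bounded set: since \<open>v_F\<close> is nondecreasing, all
  its differences are at most \<open>v_F(b) - v_F(a)\<close>.\<close>

lemma le_local_modulus:
  assumes "p \<in> {x - \<delta>/2..x + \<delta>/2} \<inter> {a..b}" "q \<in> {x - \<delta>/2..x + \<delta>/2} \<inter> {a..b}"
  shows "\<bar>variation_fun N a F p - variation_fun N a F q\<bar> \<le> local_modulus a b (variation_fun N a F) x \<delta>"
  unfolding local_modulus_def
  by (rule cSup_upper)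
    (use assms variation_fun_diff_le in \<open>auto intro!: bdd_aboveI[where M = "variation_fun N a F b - variation_fun N a F a"]\<close>)

lemma local_modulus_nonneg: "x \<in> {a..b} \<Longrightarrow> 0 \<le> \<delta> \<Longrightarrow> 0 \<le> local_modulus a b (variation_fun N a F) x \<delta>"
  using le_local_modulus[of x x \<delta> x] by simp

text \<open>A bound in the library's norm, for extracting a convergent subsequence; the bound in
  \<open>N\<close> follows below.\<close>

lemma svf_norm_bounded:
  obtains R where "\<And>t y. t \<in> {a..b} \<Longrightarrow> y \<in> F t \<Longrightarrow> norm y \<le> R"
proof -
  have "bounded (snd ` {(x, y). x \<in> {a..b} \<and> y \<in> F x})"
    by (intro compact_imp_bounded compact_continuous_image svf_compact_graph continuous_intros)
  then obtain R where "\<forall>y \<in> snd ` {(x, y). x \<in> {a..b} \<and> y \<in> F x}. norm y \<le> R"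
    unfolding bounded_iff by blast
  then show ?thesis using that[of R] by force
qed

text \<open>Compactness of the graph bounds \<open>N\<close> on all values at once, so the supremum
  in \<open>sup_norm\<close> is that of a bounded set.\<close>

lemma norm_le_sup_norm:
  assumes "t \<in> {a..b}" "y \<in> F t"
  shows "N y \<le> sup_norm N a b F"
proof -
  let ?G = "{(x, y). x \<in> {a..b} \<and> y \<in> F x}"
  have "compact ((\<lambda>z. N (snd z)) ` ?G)"
    by (intro compact_continuous_image svf_compact_graph continuous_on_compose2[OF is_norm_continuous[OF N, of UNIV]])
      (auto intro: continuous_intros)
  then have "bdd_above ((\<lambda>z. N (snd z)) ` ?G)" by (intro bounded_imp_bdd_above compact_imp_bounded)
  then obtain R where R: "\<And>t y. t \<in> {a..b} \<Longrightarrow> y \<in> F t \<Longrightarrow> N y \<le> R" by (force simp: bdd_above_def)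
  have "set_norm N (F s) \<le> R" if "s \<in> {a..b}" for s
    unfolding set_norm_def
    by (rule haus_bounds(2)[OF N]) (use svf_value[OF that] R[OF that] is_norm_minus[OF N] in auto)
  then have "set_norm N (F t) \<le> sup_norm N a b F"
    unfolding sup_norm_def by (intro cSUP_upper[OF assms(1)] bdd_aboveI2[where M = R])
  moreover have "N y \<le> set_norm N (F t)"
    using haus_attained[OF N, of "F t" "{0}" y] svf_value[OF assms(1)] assms(2)
    unfolding set_norm_def by auto
  ultimately show ?thesis by simp
qed

lemma sup_norm_nonneg: "0 \<le> sup_norm N a b F"
proof -
  obtain y where "y \<in> F a" using svf_value[of a] ab by auto
  then show ?thesis using norm_le_sup_norm[of a y] is_norm_nonneg[OF N, of y] ab by simp
qed

section \<open>Estimates for Riemann sums along chains\<close>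

text \<open>Each link is at most the increment of \<open>v_F\<close> between its nodes, and these
  increments telescope. The length \<open>m\<close> is free because the chains of weighted sums stop
  at \<open>n - 1\<close>, whereas a chain through a point of \<open>F(b)\<close> reaches
  \<open>n\<close>.\<close>

lemma chain_diff_le:
  assumes p: "is_partition a b n \<xi>" and y: "y \<in> metric_chains N m (\<lambda>i. F (\<xi> i))"
    and "m \<le> n" "i \<le> m" "l \<le> m"
  shows "N (y i - y l) \<le> \<bar>variation_fun N a F (\<xi> i) - variation_fun N a F (\<xi> l)\<bar>"
proof -
  let ?v = "\<lambda>i. variation_fun N a F (\<xi> i)"
  have link: "N (y i - y (Suc i)) \<le> ?v (Suc i) - ?v i" if "i < m" for i
  proof -
    have mem: "\<xi> i \<in> {a..b}" "\<xi> (Suc i) \<in> {a..b}" "\<xi> i \<le> \<xi> (Suc i)"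
      using partition_mem[OF p] partition_le[OF p, of i "Suc i"] that \<open>m \<le> n\<close> by auto
    have "(y i, y (Suc i)) \<in> metric_pairs N (F (\<xi> i)) (F (\<xi> (Suc i)))"
      using y that by (simp add: metric_chains_def)
    then have "N (y i - y (Suc i)) \<le> haus N (F (\<xi> i)) (F (\<xi> (Suc i)))"
      using metric_pairs_haus[OF N] svf_value[OF mem(1)] svf_value[OF mem(2)] by simp
    then show ?thesis using haus_le_variation_diff[of "\<xi> i" "\<xi> (Suc i)"] mem by auto
  qed
  have ordered: "N (y i - y l) \<le> ?v l - ?v i" if "i \<le> l" "l \<le> m" for i l
    using that
  proof (induction l rule: dec_induct)
    case base
    then show ?case by (simp add: is_norm_zero[OF N])
  next
    case (step l)
    then show ?case
      using is_norm_triangle_through[OF N, of "y i" "y (Suc l)" "y l"] link[of l] by auto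
  qed
  show ?thesis
    using ordered[of i l] ordered[of l i] is_norm_commute[OF N, of "y i" "y l"] assms(4,5)
    by (cases "i \<le> l") auto
qed

text \<open>The bound of the theorem with the integral of \<open>\<bar>\<kappa>\<bar>\<close> in
  place of \<open>M x\<close>. Its discrete version \<open>sum_estimate\<close> replaces every
  integral by a Riemann sum, with a truncated function for the integral over the far set.\<close>

definition estimate :: "real \<Rightarrow> real \<Rightarrow> (real \<Rightarrow> real) \<Rightarrow> real" where
  "estimate x \<delta> \<kappa> =
     local_modulus a b (variation_fun N a F) x (4 * \<delta>) * integral {a..b} (\<lambda>t. \<bar>\<kappa> t\<bar>)
     + sup_norm N a b F * (2 * integral {t \<in> {a..b}. \<delta> \<le> \<bar>x - t\<bar>} (\<lambda>t. \<bar>\<kappa> t\<bar>)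
       + \<bar>integral {a..b} \<kappa> - 1\<bar>)"

definition sum_estimate :: "real \<Rightarrow> real \<Rightarrow> (real \<Rightarrow> real) \<Rightarrow> nat \<Rightarrow> (nat \<Rightarrow> real) \<Rightarrow> real" where
  "sum_estimate x \<delta> \<kappa> n \<xi> =
     local_modulus a b (variation_fun N a F) x (4 * \<delta>) * riemann_sum (\<lambda>t. \<bar>\<kappa> t\<bar>) n \<xi>
     + sup_norm N a b F * (2 * riemann_sum (\<lambda>t. if \<delta> \<le> \<bar>x - t\<bar> then \<bar>\<kappa> t\<bar> else 0) n \<xi>
       + \<bar>riemann_sum \<kappa> n \<xi> - 1\<bar>)"

lemma sum_estimate_tendsto:
  assumes "bounded_variation dist a b \<kappa>" "\<And>k. is_partition a b (m k) (\<xi> k)"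
    and "(\<lambda>k. mesh (m k) (\<xi> k)) \<longlonglongrightarrow> 0"
  shows "(\<lambda>k. sum_estimate x \<delta> \<kappa> (m k) (\<xi> k)) \<longlonglongrightarrow> estimate x \<delta> \<kappa>"
proof -
  let ?far = "\<lambda>t. if \<delta> \<le> \<bar>x - t\<bar> then \<bar>\<kappa> t\<bar> else 0"
  obtain v where v: "increment_dominated a b \<kappa> v" using bounded_variation_dominated[OF assms(1)] .
  obtain w where w: "increment_dominated a b ?far w" using increment_dominated_far[OF v] .
  have "{t \<in> {a..b}. \<delta> \<le> \<bar>x - t\<bar>} = {t. \<delta> \<le> \<bar>x - t\<bar>} \<inter> {a..b}" by auto
  then have far: "integral {t \<in> {a..b}. \<delta> \<le> \<bar>x - t\<bar>} (\<lambda>t. \<bar>\<kappa> t\<bar>) = integral {a..b} ?far"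
    using Henstock_Kurzweil_Integration.integral_restrict_Int[of "{a..b}" "{t. \<delta> \<le> \<bar>x - t\<bar>}" "\<lambda>t. \<bar>\<kappa> t\<bar>"]
    by simp
  show ?thesis
    unfolding sum_estimate_def estimate_def far
    by (intro tendsto_intros riemann_sum_tendsto[OF v assms(2,3)] riemann_sum_tendsto[OF w assms(2,3)]
        riemann_sum_tendsto[OF increment_dominated_abs[OF v] assms(2,3)])
qed

text \<open>If \<open>\<xi> i\<close> and \<open>\<xi> j\<close> are within \<open>\<delta>\<close>
  of \<open>x\<close>, both lie in \<open>[x - 2\<delta>, x + 2\<delta>]\<close>, the window of the
  modulus at \<open>4\<delta>\<close>. The index \<open>j = n\<close> is allowed, so
  \<open>w\<close> may lie over \<open>b\<close>, a node that the sum does not visit.\<close>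

lemma sum_estimate_bound:
  assumes p: "is_partition a b n \<xi>" and \<delta>: "0 < \<delta>" "x \<in> {a..b}"
    and j: "j \<le> n" "\<bar>x - \<xi> j\<bar> < \<delta>" "w \<in> F (\<xi> j)"
    and y: "\<And>i. i < n \<Longrightarrow> y i \<in> F (\<xi> i)"
      "\<And>i. i < n \<Longrightarrow> N (y i - w) \<le> \<bar>variation_fun N a F (\<xi> i) - variation_fun N a F (\<xi> j)\<bar>"
  shows "N ((\<Sum>i<n. ((\<xi> (Suc i) - \<xi> i) * \<kappa> (\<xi> i)) *\<^sub>R y i) - w) \<le> sum_estimate x \<delta> \<kappa> n \<xi>"
  unfolding sum_estimate_def
proof (rule weighted_sum_estimate[OF N])
  show "\<xi> i \<le> \<xi> (Suc i)" if "i < n" for i using partition_le[OF p, of i "Suc i"] that by simp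
  show "N w \<le> sup_norm N a b F" using norm_le_sup_norm[OF partition_mem[OF p j(1)] j(3)] .
  show "N (y i) \<le> sup_norm N a b F" if "i < n" for i
    using norm_le_sup_norm[OF partition_mem[OF p, of i] y(1)] that by simp
  show "0 \<le> local_modulus a b (variation_fun N a F) x (4 * \<delta>)" using local_modulus_nonneg \<delta> by simp
  show "N (y i - w) \<le> local_modulus a b (variation_fun N a F) x (4 * \<delta>)"
    if "i < n" "\<bar>x - \<xi> i\<bar> < \<delta>" for i
    using y(2)[OF that(1)] le_local_modulus[of "\<xi> i" x "4 * \<delta>" "\<xi> j"] that j
      partition_mem[OF p, of i] partition_mem[OF p, of j] by (auto simp: abs_less_iff)
qed

section \<open>The two halves of the Hausdorff estimate\<close>

text \<open>In each approximating chain the reference point is the one over the left end of a cell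
  containing \<open>x\<close>. Its node is within the mesh of \<open>x\<close> and always carries a
  point of the chain.\<close>

lemma metric_integral_near_value:
  assumes \<kappa>: "bounded_variation dist a b \<kappa>" and x: "x \<in> {a..b}" and \<delta>: "0 < \<delta>"
    and z: "z \<in> weighted_metric_integral N a b \<kappa> F"
  shows "\<exists>w\<in>F x. N (z - w) \<le> estimate x \<delta> \<kappa>"
proof -
  let ?sum = "\<lambda>n \<xi> y. \<Sum>i<n. ((\<xi> (Suc i) - \<xi> i) * \<kappa> (\<xi> i)) *\<^sub>R (y i :: real ^ 'd)"
  obtain m \<xi> zs where p: "\<And>k. is_partition a b (m k) (\<xi> k)"
    and zs: "\<And>k. zs k \<in> weighted_sums N \<kappa> F (m k) (\<xi> k)"
    and mesh: "(\<lambda>k. mesh (m k) (\<xi> k)) \<longlonglongrightarrow> 0" and lim: "zs \<longlonglongrightarrow> z"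
    using z unfolding weighted_metric_integral_def by auto
  have "\<forall>k. \<exists>y j. y \<in> metric_chains N (m k - 1) (\<lambda>i. F (\<xi> k i)) \<and> zs k = ?sum (m k) (\<xi> k) y
      \<and> j < m k \<and> \<xi> k j \<le> x \<and> x \<le> \<xi> k (Suc j)"
  proof
    fix k
    have "\<exists>j<m k. \<xi> k j \<le> x \<and> x \<le> \<xi> k (Suc j)"
    proof (cases "x < b")
      case True
      then show ?thesis using partition_cell[OF p, of x k] x by (metis atLeastAtMost_iff less_imp_le)
    next
      case False
      \<comment> \<open>Here \<open>x = b\<close> belongs to the last cell, taken with its right
        end; its left node has the last index of the chain.\<close>
      have "m k \<noteq> 0" using p[of k] ab by (auto simp: is_partition_def intro: ccontr)
      then obtain l where "m k = Suc l" using not0_implies_Suc by blast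
      then show ?thesis
        using p[of k] partition_mem[OF p, of l k] False x by (intro exI[of _ l]) (auto simp: is_partition_def)
    qed
    then show "\<exists>y j. y \<in> metric_chains N (m k - 1) (\<lambda>i. F (\<xi> k i)) \<and> zs k = ?sum (m k) (\<xi> k) y
        \<and> j < m k \<and> \<xi> k j \<le> x \<and> x \<le> \<xi> k (Suc j)"
      using zs[of k] unfolding weighted_sums_def by blast
  qed
  then obtain y j where y: "\<And>k. y k \<in> metric_chains N (m k - 1) (\<lambda>i. F (\<xi> k i))"
    and sum: "\<And>k. zs k = ?sum (m k) (\<xi> k) (y k)"
    and j: "\<And>k. j k < m k" "\<And>k. \<xi> k (j k) \<le> x" "\<And>k. x \<le> \<xi> k (Suc (j k))"
    unfolding choice_iff by blast
  have close: "\<bar>x - \<xi> k (j k)\<bar> \<le> mesh (m k) (\<xi> k)" for k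
    using mesh_ge[OF j(1), of "\<xi> k" k] j(2,3)[of k] by simp
  have mem: "y k i \<in> F (\<xi> k i)" if "i < m k" for k i
    using y[of k] that by (simp add: metric_chains_def)
  let ?G = "{(x, y). x \<in> {a..b} \<and> y \<in> F x}"
  have "\<forall>k. (\<xi> k (j k), y k (j k)) \<in> ?G"
    using mem j(1) partition_mem[OF p] by (auto simp: less_imp_le)
  \<comment> \<open>Nodes and reference points converge together to a point of the graph. Its first
    component is \<open>x\<close>, so its second lies in \<open>F x\<close>.\<close>
  then obtain l r where l: "l \<in> ?G" "strict_mono r"
      "((\<lambda>k. (\<xi> k (j k), y k (j k))) \<circ> r) \<longlonglongrightarrow> l"
    using svf_compact_graph unfolding compact_def by (metis (no_types, lifting))
  have "(\<lambda>k. x - \<xi> k (j k)) \<longlonglongrightarrow> 0"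
    by (rule Lim_null_comparison[OF _ mesh]) (use close in \<open>simp add: always_eventually\<close>)
  then have "(\<lambda>k. x - (x - \<xi> k (j k))) \<longlonglongrightarrow> x - 0" by (intro tendsto_intros)
  then have "(\<lambda>k. \<xi> (r k) (j (r k))) \<longlonglongrightarrow> x"
    using LIMSEQ_subseq_LIMSEQ[OF _ l(2), of "\<lambda>k. \<xi> k (j k)" x] by (simp add: comp_def)
  moreover have "(\<lambda>k. \<xi> (r k) (j (r k))) \<longlonglongrightarrow> fst l"
    using tendsto_fst[OF l(3)] by (simp add: comp_def)
  ultimately have "fst l = x" using LIMSEQ_unique by blast
  then have w: "snd l \<in> F x" using l(1) by (cases l) auto
  have yl: "(\<lambda>k. y (r k) (j (r k))) \<longlonglongrightarrow> snd l"
    using tendsto_snd[OF l(3)] by (simp add: comp_def)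
  have "(\<lambda>k. N (zs (r k) - y (r k) (j (r k)))) \<longlonglongrightarrow> N (z - snd l)"
    using LIMSEQ_subseq_LIMSEQ[OF lim l(2)] yl
    by (intro is_norm_tendsto[OF N] tendsto_diff) (simp_all add: comp_def)
  moreover have "(\<lambda>k. sum_estimate x \<delta> \<kappa> (m (r k)) (\<xi> (r k))) \<longlonglongrightarrow> estimate x \<delta> \<kappa>"
    using LIMSEQ_subseq_LIMSEQ[OF sum_estimate_tendsto[OF \<kappa> p mesh] l(2)] by (simp add: comp_def)
  moreover have "\<forall>\<^sub>F k in sequentially. N (zs k - y k (j k)) \<le> sum_estimate x \<delta> \<kappa> (m k) (\<xi> k)"
    using order_tendstoD(2)[OF mesh \<delta>]
  proof eventually_elim
    case (elim k)
    show ?case unfolding sum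
    proof (rule sum_estimate_bound[OF p \<delta> x])
      show "\<bar>x - \<xi> k (j k)\<bar> < \<delta>" using close[of k] elim by simp
      show "N (y k i - y k (j k)) \<le> \<bar>variation_fun N a F (\<xi> k i) - variation_fun N a F (\<xi> k (j k))\<bar>"
        if "i < m k" for i
        using chain_diff_le[OF p y, of k i "j k"] that j(1)[of k] by simp
    qed (use mem j(1)[of k] in auto)
  qed
  then have "\<forall>\<^sub>F k in sequentially. N (zs (r k) - y (r k) (j (r k))) \<le> sum_estimate x \<delta> \<kappa> (m (r k)) (\<xi> (r k))"
    by (rule eventually_subseq[OF l(2)])
  ultimately have "N (z - snd l) \<le> estimate x \<delta> \<kappa>"
    by (intro tendsto_le[OF sequentially_bot])
  then show ?thesis using w by blast
qed

text \<open>
  The chain is built over all nodes, including \<open>\<xi>\<^sub>n = b\<close>, which does not occur in the weighted sum: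
  for \<open>x = b\<close> it has to pass through \<open>w \<in> F(b)\<close>, and \<open>F\<close> need not be continuous at \<open>b\<close>.
\<close>

lemma value_near_metric_integral:
  assumes \<kappa>: "bounded_variation dist a b \<kappa>" and x: "x \<in> {a..b}" and \<delta>: "0 < \<delta>" and w: "w \<in> F x"
  shows "\<exists>z\<in>weighted_metric_integral N a b \<kappa> F. N (z - w) \<le> estimate x \<delta> \<kappa>"
proof -
  let ?sum = "\<lambda>n \<xi> y. \<Sum>i<n. ((\<xi> (Suc i) - \<xi> i) * \<kappa> (\<xi> i)) *\<^sub>R (y i :: real ^ 'd)"
  have "\<forall>k::nat. \<exists>n \<xi> j y. is_partition a b n \<xi> \<and> (\<forall>i<n. \<xi> (Suc i) - \<xi> i < 1 / (real k + 1)) \<and> j \<le> n \<and> \<xi> j = x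
      \<and> y \<in> metric_chains N n (\<lambda>i. F (\<xi> i)) \<and> y j = w"
  proof
    fix k :: nat
    have "0 < 1 / (real k + 1)" by simp
    then obtain n \<xi> j
      where p: "is_partition a b n \<xi>" "\<And>i. i < n \<Longrightarrow> \<xi> (Suc i) - \<xi> i < 1 / (real k + 1)" "j \<le> n" "\<xi> j = x"
      using fine_partition_through_exists[OF x] by blast
    moreover have "\<exists>y\<in>metric_chains N n (\<lambda>i. F (\<xi> i)). y j = w"
      using p w partition_mem[OF p(1)] by (intro metric_chain_through[OF N] svf_value) auto
    ultimately show "\<exists>n \<xi> j y. is_partition a b n \<xi> \<and> (\<forall>i<n. \<xi> (Suc i) - \<xi> i < 1 / (real k + 1)) \<and> j \<le> n \<and> \<xi> j = x
      \<and> y \<in> metric_chains N n (\<lambda>i. F (\<xi> i)) \<and> y j = w"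
      by blast
  qed
  then obtain m \<xi> j y where p: "\<And>k. is_partition a b (m k) (\<xi> k)"
    and fine: "\<And>k i. i < m k \<Longrightarrow> \<xi> k (Suc i) - \<xi> k i < 1 / (real k + 1)"
    and j: "\<And>k. j k \<le> m k" "\<And>k. \<xi> k (j k) = x"
    and y: "\<And>k. y k \<in> metric_chains N (m k) (\<lambda>i. F (\<xi> k i))" "\<And>k. y k (j k) = w"
    unfolding choice_iff by blast
  define zs where "zs k = ?sum (m k) (\<xi> k) (y k)" for k
  \<comment> \<open>Since \<open>a < b\<close> there is at least one cell, so the mesh is the
    maximum of a nonempty set.\<close>
  have pos: "m k \<noteq> 0" for k using p[of k] ab by (auto simp: is_partition_def intro: ccontr)
  have mem: "y k i \<in> F (\<xi> k i)" if "i \<le> m k" for k i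
    using y(1)[of k] that by (simp add: metric_chains_def)
  have inc: "\<xi> k i \<le> \<xi> k (Suc i)" if "i < m k" for k i using partition_le[OF p, of i "Suc i" k] that by simp
  have mesh: "(\<lambda>k. mesh (m k) (\<xi> k)) \<longlonglongrightarrow> 0"
  proof (rule Lim_null_comparison)
    have "norm (mesh (m k) (\<xi> k)) \<le> inverse (real (Suc k))" for k
    proof -
      have "0 \<le> mesh (m k) (\<xi> k)" using mesh_ge[of 0 "m k" "\<xi> k"] inc[of 0 k] pos[of k] by simp
      moreover have "mesh (m k) (\<xi> k) \<le> 1 / (real k + 1)"
        unfolding mesh_def using pos[of k] fine[of _ k] by (intro Max.boundedI) (auto simp: less_imp_le)
      ultimately show ?thesis by (simp add: field_simps)
    qed
    then show "\<forall>\<^sub>F k in sequentially. norm (mesh (m k) (\<xi> k)) \<le> inverse (real (Suc k))" by simp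
  qed (rule LIMSEQ_inverse_real_of_nat)
  have bound: "N (zs k - w) \<le> sum_estimate x \<delta> \<kappa> (m k) (\<xi> k)" for k
    unfolding zs_def
  proof (rule sum_estimate_bound[OF p \<delta> x j(1)])
    show "N (y k i - w) \<le> \<bar>variation_fun N a F (\<xi> k i) - variation_fun N a F (\<xi> k (j k))\<bar>" if "i < m k" for i
      using chain_diff_le[OF p y(1), of k i "j k"] that j(1)[of k] y(2)[of k] by simp
  qed (use mem w j(2) \<delta> in \<open>auto simp: less_imp_le\<close>)
  obtain R where R: "\<And>t y. t \<in> {a..b} \<Longrightarrow> y \<in> F t \<Longrightarrow> norm y \<le> R" using svf_norm_bounded by blast
  obtain v where v: "increment_dominated a b \<kappa> v" using bounded_variation_dominated[OF \<kappa>] .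
  have zs_le: "norm (zs k) \<le> R * riemann_sum (\<lambda>t. \<bar>\<kappa> t\<bar>) (m k) (\<xi> k)" for k
    unfolding zs_def riemann_sum_def sum_distrib_left
  proof (rule sum_norm_le)
    fix i assume "i \<in> {..<m k}"
    then have i: "i < m k" by simp
    have "norm (y k i) \<le> R" using R[OF partition_mem[OF p] mem] i by simp
    then have "\<bar>(\<xi> k (Suc i) - \<xi> k i) * \<kappa> (\<xi> k i)\<bar> * norm (y k i) \<le> \<bar>(\<xi> k (Suc i) - \<xi> k i) * \<kappa> (\<xi> k i)\<bar> * R"
      by (rule mult_left_mono) simp
    then show "norm (((\<xi> k (Suc i) - \<xi> k i) * \<kappa> (\<xi> k i)) *\<^sub>R y k i)
        \<le> R * ((\<xi> k (Suc i) - \<xi> k i) * \<bar>\<kappa> (\<xi> k i)\<bar>)"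
      using inc[OF i] by (simp add: abs_mult mult_ac)
  qed
  have "(\<lambda>k. R * riemann_sum (\<lambda>t. \<bar>\<kappa> t\<bar>) (m k) (\<xi> k)) \<longlonglongrightarrow> R * integral {a..b} (\<lambda>t. \<bar>\<kappa> t\<bar>)"
    by (intro tendsto_intros riemann_sum_tendsto[OF increment_dominated_abs[OF v] p mesh])
  then have "bounded (range (\<lambda>k. R * riemann_sum (\<lambda>t. \<bar>\<kappa> t\<bar>) (m k) (\<xi> k)))"
    by (rule convergent_imp_bounded)
  then obtain C where "\<And>k. \<bar>R * riemann_sum (\<lambda>t. \<bar>\<kappa> t\<bar>) (m k) (\<xi> k)\<bar> \<le> C"
    by (auto simp: bounded_iff)
  then have "norm (zs k) \<le> C" for k using zs_le[of k] by (meson abs_le_D1 order_trans)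
  then have "bounded (range zs)" by (auto simp: bounded_iff)
  \<comment> \<open>The sums are bounded in a finite-dimensional space; a subsequential limit
    belongs to the integral by its definition as an upper limit.\<close>
  then obtain z r where r: "strict_mono r" "(zs \<circ> r) \<longlonglongrightarrow> z"
    using bounded_imp_convergent_subsequence by blast
  have "z \<in> weighted_metric_integral N a b \<kappa> F"
    unfolding weighted_metric_integral_def
  proof (intro CollectI exI conjI allI)
    show "is_partition a b ((m \<circ> r) k) ((\<xi> \<circ> r) k)" for k using p by simp
    show "(zs \<circ> r) k \<in> weighted_sums N \<kappa> F ((m \<circ> r) k) ((\<xi> \<circ> r) k)" for k
      \<comment> \<open>The point over the last node is dropped from the chain; the sum, over
        indices below \<open>m (r k)\<close>, does not change.\<close>
      using metric_chains_restrict[OF N y(1)[of "r k"], of "m (r k) - 1"]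
      by (auto simp: weighted_sums_def zs_def)
    show "(\<lambda>k. mesh ((m \<circ> r) k) ((\<xi> \<circ> r) k)) \<longlonglongrightarrow> 0"
      using LIMSEQ_subseq_LIMSEQ[OF mesh r(1)] by (simp add: comp_def)
  qed (rule r(2))
  moreover have "N (z - w) \<le> estimate x \<delta> \<kappa>"
  proof (rule LIMSEQ_le)
    show "(\<lambda>k. N ((zs \<circ> r) k - w)) \<longlonglongrightarrow> N (z - w)"
      by (intro is_norm_tendsto[OF N] tendsto_intros r(2))
    show "(\<lambda>k. sum_estimate x \<delta> \<kappa> (m (r k)) (\<xi> (r k))) \<longlonglongrightarrow> estimate x \<delta> \<kappa>"
      using LIMSEQ_subseq_LIMSEQ[OF sum_estimate_tendsto[OF \<kappa> p mesh] r(1)] by (simp add: comp_def)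
  qed (use bound in auto)
  ultimately show ?thesis by blast
qed

text \<open>The two halves are the two approximations required by \<open>haus_bounds\<close>.
  Nonnegativity is recorded to turn the upper bound into convergence to 0.\<close>

lemma metric_integral_haus:
  assumes \<kappa>: "bounded_variation dist a b \<kappa>" and x: "x \<in> {a..b}" and \<delta>: "0 < \<delta>"
  shows "0 \<le> haus N (weighted_metric_integral N a b \<kappa> F) (F x)"
    and "haus N (weighted_metric_integral N a b \<kappa> F) (F x) \<le> estimate x \<delta> \<kappa>"
proof -
  let ?T = "weighted_metric_integral N a b \<kappa> F"
  have T: "?T \<noteq> {}" using value_near_metric_integral[OF assms] svf_value[OF x] by blast
  have *: "\<exists>z\<in>?T. N (w - z) \<le> estimate x \<delta> \<kappa>" if "w \<in> F x" for w
    using value_near_metric_integral[OF assms that] is_norm_commute[OF N] by metis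
  show "0 \<le> haus N ?T (F x)"
    using haus_bounds(1)[OF N T _ metric_integral_near_value[OF assms] *] svf_value[OF x] by blast
  show "haus N ?T (F x) \<le> estimate x \<delta> \<kappa>"
    using haus_bounds(2)[OF N T _ metric_integral_near_value[OF assms] *] svf_value[OF x] by blast
qed

section \<open>Passage to the limit in the estimate\<close>

lemma variation_fun_continuous:
  assumes "x \<in> {a..b}" "svf_continuous_at N a b F x"
  shows "(variation_fun N a F \<longlongrightarrow> variation_fun N a F x) (at x within {a..b})"
  unfolding variation_fun_def
proof (rule variation_continuous[OF svf_bounded_variation assms(1)])
  fix r s t assume "r \<in> {a..b}" "s \<in> {a..b}" "t \<in> {a..b}"
  then show "haus N (F t) (F r) \<le> haus N (F t) (F s) + haus N (F s) (F r)"
    by (intro haus_triangle[OF N]) (simp_all add: svf_value)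
qed (use assms svf_haus_nonneg haus_commute[OF N] haus_refl[OF N] svf_value in \<open>auto simp: svf_continuous_at_def\<close>)

text \<open>The window around a point of \<open>[c,d]\<close> may leave \<open>[c,d]\<close>, so
  uniform continuity on \<open>[c,d]\<close> alone would be too little. Points violating every
  \<open>\<delta>\<close> have a subsequence along which the centres and both neighbours converge to
  one \<open>l\<close> in \<open>[c,d]\<close>, where \<open>v_F\<close> is continuous relative to
  \<open>[a,b]\<close>.\<close>

lemma local_modulus_uniformly_small:
  assumes I: "{c..d} \<subseteq> {a..b}" and cont: "\<And>x. x \<in> {c..d} \<Longrightarrow> svf_continuous_at N a b F x" and e: "0 < e"
  obtains \<delta> where "0 < \<delta>" "\<And>\<eta> x. 0 < \<eta> \<Longrightarrow> \<eta> < \<delta> \<Longrightarrow> x \<in> {c..d} \<Longrightarrow>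
      local_modulus a b (variation_fun N a F) x \<eta> \<le> e"
proof -
  let ?v = "variation_fun N a F"
  have "\<exists>\<delta>>0. \<forall>x\<in>{c..d}. \<forall>s\<in>{a..b}. \<forall>t\<in>{a..b}. \<bar>s - x\<bar> < \<delta> \<longrightarrow> \<bar>t - x\<bar> < \<delta> \<longrightarrow> \<bar>?v s - ?v t\<bar> \<le> e"
  proof (rule ccontr)
    assume neg: "\<not> ?thesis"
    have "\<exists>x s t. x \<in> {c..d} \<and> s \<in> {a..b} \<and> t \<in> {a..b} \<and> \<bar>s - x\<bar> < inverse (real (Suc k))
        \<and> \<bar>t - x\<bar> < inverse (real (Suc k)) \<and> e < \<bar>?v s - ?v t\<bar>" for k
    proof -
      have "0 < inverse (real (Suc k))" by simp
      then show ?thesis using neg by (meson not_le)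
    qed
    then obtain x s t where mem: "\<And>k. x k \<in> {c..d}" "\<And>k. s k \<in> {a..b}" "\<And>k. t k \<in> {a..b}"
      and s: "\<And>k. \<bar>s k - x k\<bar> < inverse (real (Suc k))"
      and t: "\<And>k. \<bar>t k - x k\<bar> < inverse (real (Suc k))" and big: "\<And>k. e < \<bar>?v (s k) - ?v (t k)\<bar>"
      by metis
    obtain l r where l: "l \<in> {c..d}" "strict_mono r" "(x \<circ> r) \<longlonglongrightarrow> l"
      using mem(1) compact_Icc[of c d] unfolding compact_def by metis
    have v: "(\<lambda>k. ?v (u (r k))) \<longlonglongrightarrow> ?v l"
      if u: "\<And>k. u k \<in> {a..b}" "\<And>k. \<bar>u k - x k\<bar> < inverse (real (Suc k))" for u
    proof -
      have "(\<lambda>k. u k - x k) \<longlonglongrightarrow> 0"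
        by (rule Lim_null_comparison[OF _ LIMSEQ_inverse_real_of_nat])
          (use u(2) in \<open>auto intro!: always_eventually less_imp_le\<close>)
      from tendsto_add[OF LIMSEQ_subseq_LIMSEQ[OF this l(2)] l(3)] have "(\<lambda>k. u (r k)) \<longlonglongrightarrow> l"
        by (simp add: comp_def)
      moreover have "continuous (at l within {a..b}) ?v"
        using variation_fun_continuous[of l] cont[OF l(1)] l(1) I by (auto simp: continuous_within)
      ultimately show ?thesis
        using u(1) by (auto simp: continuous_within_sequentially comp_def)
    qed
    have "(\<lambda>k. \<bar>?v (s (r k)) - ?v (t (r k))\<bar>) \<longlonglongrightarrow> \<bar>?v l - ?v l\<bar>"
      by (intro tendsto_intros v mem s t)
    then have "e \<le> \<bar>?v l - ?v l\<bar>"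
      by (rule LIMSEQ_le_const) (use big in \<open>auto intro: less_imp_le\<close>)
    then show False using e by simp
  qed
  then obtain \<delta> where \<delta>: "0 < \<delta>" "\<And>x s t. x \<in> {c..d} \<Longrightarrow> s \<in> {a..b} \<Longrightarrow> t \<in> {a..b} \<Longrightarrow>
      \<bar>s - x\<bar> < \<delta> \<Longrightarrow> \<bar>t - x\<bar> < \<delta> \<Longrightarrow> \<bar>?v s - ?v t\<bar> \<le> e" by blast
  show ?thesis
  proof (rule that[OF \<delta>(1)])
    fix \<eta> x assume \<eta>: "0 < \<eta>" "\<eta> < \<delta>" "x \<in> {c..d}"
    show "local_modulus a b ?v x \<eta> \<le> e"
      unfolding local_modulus_def
    proof (rule cSup_least)
      \<comment> \<open>The centre itself lies in the window, so the supremum is over a nonempty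
        set.\<close>
      have "x \<in> {x - \<eta>/2..x + \<eta>/2} \<inter> {a..b}" using \<eta> I by auto
      then show "{\<bar>?v x1 - ?v x2\<bar> |x1 x2. x1 \<in> {x - \<eta>/2..x + \<eta>/2} \<inter> {a..b} \<and>
          x2 \<in> {x - \<eta>/2..x + \<eta>/2} \<inter> {a..b}} \<noteq> {}" by blast
    qed (use \<eta> in \<open>auto intro!: \<delta>(2)[OF \<eta>(3)]\<close>)
  qed
qed

text \<open>The modulus term is made small by choosing \<open>\<delta>\<close>, uniformly in
  \<open>x\<close>; then \<open>n\<close> is taken large for this fixed
  \<open>\<delta>\<close>.\<close>

lemma metric_operator_uniform_limit:
  assumes K: "\<And>n x. x \<in> {a..b} \<Longrightarrow> bounded_variation dist a b (\<lambda>t. K n x t)"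
    and I: "{c..d} \<subseteq> {a..b}" and cont: "\<And>x. x \<in> {c..d} \<Longrightarrow> svf_continuous_at N a b F x"
    and \<alpha>: "uniform_limit {c..d} (\<lambda>n x. kernel_alpha a b K n x) (\<lambda>x. 0) sequentially"
    and \<delta>0: "0 < \<delta>0" and \<beta>: "\<And>\<delta>. 0 < \<delta> \<Longrightarrow> \<delta> < \<delta>0 \<Longrightarrow>
        uniform_limit {c..d} (\<lambda>n x. kernel_beta a b K n x \<delta>) (\<lambda>x. 0) sequentially"
    and C: "\<And>n x. x \<in> {c..d} \<Longrightarrow> integral {a..b} (\<lambda>t. \<bar>K n x t\<bar>) \<le> C"
  shows "uniform_limit {c..d} (\<lambda>n x. haus N (metric_operator N a b K n F x) (F x)) (\<lambda>x. 0) sequentially"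
proof (rule uniform_limitI)
  fix e :: real assume e: "0 < e"
  let ?S = "sup_norm N a b F"
  \<comment> \<open>The maximum with 1 makes \<open>C'\<close> positive, so it may be divided
    by.\<close>
  define C' where "C' = max C 1"
  \<comment> \<open>The modulus term will take \<open>e / 3\<close>, and the kernel terms at most
    \<open>3 * e' * (?S + 1) = e / 2\<close>. Adding 1 covers \<open>?S = 0\<close>.\<close>
  define e' where "e' = e / (6 * (?S + 1))"
  have C': "0 < C'" "C \<le> C'" by (auto simp: C'_def)
  have e': "0 < e'" using e sup_norm_nonneg by (simp add: e'_def)
  obtain \<eta> where \<eta>: "0 < \<eta>" "\<And>\<zeta> x. 0 < \<zeta> \<Longrightarrow> \<zeta> < \<eta> \<Longrightarrow> x \<in> {c..d} \<Longrightarrow>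
      local_modulus a b (variation_fun N a F) x \<zeta> \<le> e / (3 * C')"
    using local_modulus_uniformly_small[OF I cont, of "e / (3 * C')"] e C' by auto
  \<comment> \<open>Small enough for both the hypothesis on \<open>kernel_beta\<close> and a modulus
    window of width \<open>4 * \<delta>\<close> below \<open>\<eta>\<close>.\<close>
  define \<delta> where "\<delta> = min (\<delta>0 / 2) (\<eta> / 8)"
  have \<delta>: "0 < \<delta>" "\<delta> < \<delta>0" "4 * \<delta> < \<eta>" using \<delta>0 \<eta>(1) by (auto simp: \<delta>_def min_def)
  show "\<forall>\<^sub>F n in sequentially. \<forall>x\<in>{c..d}. dist (haus N (metric_operator N a b K n F x) (F x)) 0 < e"
    using uniform_limitD[OF \<alpha> e'] uniform_limitD[OF \<beta>[OF \<delta>(1,2)] e']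
  proof eventually_elim
    case (elim n)
    show ?case
    proof
      fix x assume x: "x \<in> {c..d}"
      then have xab: "x \<in> {a..b}" using I by blast
      have "local_modulus a b (variation_fun N a F) x (4 * \<delta>) * integral {a..b} (\<lambda>t. \<bar>K n x t\<bar>) \<le> e / (3 * C') * C'"
      proof (rule mult_mono)
        show "integral {a..b} (\<lambda>t. \<bar>K n x t\<bar>) \<le> C'" using C[OF x, of n] C'(2) by simp
        obtain v where v: "increment_dominated a b (K n x) v" using bounded_variation_dominated[OF K[OF xab]] .
        show "0 \<le> integral {a..b} (\<lambda>t. \<bar>K n x t\<bar>)"
          using increment_dominated_integrable[OF increment_dominated_abs[OF v]]
          by (rule Henstock_Kurzweil_Integration.integral_nonneg) simp
      qed (use \<eta>(2)[OF _ \<delta>(3) x] \<delta> e C' in auto)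
      also have "\<dots> = e / 3" using C' by simp
      finally have 1: "local_modulus a b (variation_fun N a F) x (4 * \<delta>) * integral {a..b} (\<lambda>t. \<bar>K n x t\<bar>) \<le> e / 3" .
      have "\<bar>kernel_alpha a b K n x\<bar> < e'" "\<bar>kernel_beta a b K n x \<delta>\<bar> < e'"
        using elim x by (auto simp: dist_real_def)
      then have "2 * kernel_beta a b K n x \<delta> + kernel_alpha a b K n x \<le> 3 * e'" by simp
      then have "?S * (2 * kernel_beta a b K n x \<delta> + kernel_alpha a b K n x) \<le> ?S * (3 * e')"
        using sup_norm_nonneg by (intro mult_left_mono)
      also have "\<dots> \<le> (?S + 1) * (3 * e')" using e' by simp
      also have "\<dots> = e / 2" using sup_norm_nonneg by (simp add: e'_def field_simps)
      finally have "estimate x \<delta> (K n x) < e"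
        using 1 e by (simp add: estimate_def kernel_alpha_def kernel_beta_def)
      then show "dist (haus N (metric_operator N a b K n F x) (F x)) 0 < e"
        using metric_integral_haus[OF K[OF xab] xab \<delta>(1), of n] by (simp add: metric_operator_def dist_real_def)
    qed
  qed
qed

end

section \<open>The estimate and the two convergence statements\<close>

theorem theorem4p2:
  fixes N :: "real ^ 'd \<Rightarrow> real"
    and a b :: real
    and F :: "real \<Rightarrow> (real ^ 'd) set"
    and K :: "nat \<Rightarrow> real \<Rightarrow> real \<Rightarrow> real"
    and M :: "real \<Rightarrow> ereal"
  assumes "is_norm N"
    and "a < b"
    and "F \<in> svf_class N a b"
    and "\<forall>n. \<forall>x\<in>{a..b}. bounded_variation dist a b (\<lambda>t. K n x t)"
    and "\<forall>x\<in>{a..b}. 0 \<le> M x"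
    and "\<forall>x\<in>{a..b}. \<forall>n. ereal (integral {a..b} (\<lambda>t. \<bar>K n x t\<bar>)) \<le> M x"
  shows
    "(\<forall>x\<in>{a..b}. \<forall>\<delta>>0. \<forall>n.
        ereal (haus N (metric_operator N a b K n F x) (F x))
          \<le> ereal (local_modulus a b (variation_fun N a F) x (4 * \<delta>)) * M x
            + ereal (sup_norm N a b F * (2 * kernel_beta a b K n x \<delta> + kernel_alpha a b K n x))) \<and>
     (\<forall>x\<in>{a..b}.
        (\<lambda>n. kernel_alpha a b K n x) \<longlonglongrightarrow> 0 \<longrightarrow>
        (\<exists>\<delta>0>0. \<forall>\<delta>. 0 < \<delta> \<and> \<delta> < \<delta>0 \<longrightarrow> (\<lambda>n. kernel_beta a b K n x \<delta>) \<longlonglongrightarrow> 0) \<longrightarrow>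
        M x < \<infinity> \<longrightarrow>
        svf_continuous_at N a b F x \<longrightarrow>
        (\<lambda>n. haus N (metric_operator N a b K n F x) (F x)) \<longlonglongrightarrow> 0) \<and>
     (\<forall>c d. {c..d} \<subseteq> {a..b} \<longrightarrow>
        (\<forall>x\<in>{c..d}. svf_continuous_at N a b F x) \<longrightarrow>
        uniform_limit {c..d} (\<lambda>n x. kernel_alpha a b K n x) (\<lambda>x. 0) sequentially \<longrightarrow>
        (\<exists>\<delta>0>0. \<forall>\<delta>. 0 < \<delta> \<and> \<delta> < \<delta>0 \<longrightarrow>
           uniform_limit {c..d} (\<lambda>n x. kernel_beta a b K n x \<delta>) (\<lambda>x. 0) sequentially) \<longrightarrow>
        (\<exists>C::real. \<forall>x\<in>{c..d}. M x \<le> ereal C) \<longrightarrow>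
        uniform_limit {c..d} (\<lambda>n x. haus N (metric_operator N a b K n F x) (F x)) (\<lambda>x. 0) sequentially)"
proof (intro conjI ballI allI impI)
  fix x \<delta> :: real and n assume x: "x \<in> {a..b}" and \<delta>: "0 < \<delta>"
  let ?\<omega> = "local_modulus a b (variation_fun N a F) x (4 * \<delta>)"
  let ?I = "integral {a..b} (\<lambda>t. \<bar>K n x t\<bar>)"
  let ?r = "sup_norm N a b F * (2 * kernel_beta a b K n x \<delta> + kernel_alpha a b K n x)"
  have "haus N (metric_operator N a b K n F x) (F x) \<le> ?\<omega> * ?I + ?r"
    using metric_integral_haus(2)[OF assms(1-3) assms(4)[rule_format, OF x] x \<delta>, of n]
    by (simp add: estimate_def[OF assms(1-3)] metric_operator_def kernel_alpha_def kernel_beta_def)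
  then have "ereal (haus N (metric_operator N a b K n F x) (F x)) \<le> ereal ?\<omega> * ereal ?I + ereal ?r"
    by simp
  \<comment> \<open>Multiplication by the nonnegative modulus is monotone even for
    \<open>M x = \<infinity>\<close>; if the modulus is 0, the product is 0 by the convention for
    extended reals.\<close>
  also have "\<dots> \<le> ereal ?\<omega> * M x + ereal ?r"
    using assms(6) x local_modulus_nonneg[OF assms(1-3) x, of "4 * \<delta>"] \<delta>
    by (intro add_right_mono ereal_mult_left_mono) auto
  finally show "ereal (haus N (metric_operator N a b K n F x) (F x)) \<le> ereal ?\<omega> * M x + ereal ?r" .
next
  fix c d
  assume I: "{c..d} \<subseteq> {a..b}" and cont: "\<forall>x\<in>{c..d}. svf_continuous_at N a b F x"
    and \<alpha>: "uniform_limit {c..d} (\<lambda>n x. kernel_alpha a b K n x) (\<lambda>x. 0) sequentially"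
    and \<beta>: "\<exists>\<delta>0>0. \<forall>\<delta>. 0 < \<delta> \<and> \<delta> < \<delta>0 \<longrightarrow>
      uniform_limit {c..d} (\<lambda>n x. kernel_beta a b K n x \<delta>) (\<lambda>x. 0) sequentially"
    and C: "\<exists>C::real. \<forall>x\<in>{c..d}. M x \<le> ereal C"
  from C obtain C where C: "\<And>x. x \<in> {c..d} \<Longrightarrow> M x \<le> ereal C" by blast
  have C': "integral {a..b} (\<lambda>t. \<bar>K n x t\<bar>) \<le> C" if "x \<in> {c..d}" for n x
  proof -
    have "ereal (integral {a..b} (\<lambda>t. \<bar>K n x t\<bar>)) \<le> ereal C"
      using order_trans[OF _ C[OF that]] assms(6) I that by blast
    then show ?thesis by simp
  qed
  from \<beta> obtain \<delta>0 where \<delta>0: "0 < \<delta>0" "\<And>\<delta>. 0 < \<delta> \<Longrightarrow> \<delta> < \<delta>0 \<Longrightarrow>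
      uniform_limit {c..d} (\<lambda>n x. kernel_beta a b K n x \<delta>) (\<lambda>x. 0) sequentially" by blast
  show "uniform_limit {c..d} (\<lambda>n x. haus N (metric_operator N a b K n F x) (F x)) (\<lambda>x. 0) sequentially"
    using assms(4) cont
    by (intro metric_operator_uniform_limit[OF assms(1-3) _ I _ \<alpha> \<delta>0 C']) auto
next
  fix x assume x: "x \<in> {a..b}"
    and \<alpha>: "(\<lambda>n. kernel_alpha a b K n x) \<longlonglongrightarrow> 0"
    and \<beta>: "\<exists>\<delta>0>0. \<forall>\<delta>. 0 < \<delta> \<and> \<delta> < \<delta>0 \<longrightarrow> (\<lambda>n. kernel_beta a b K n x \<delta>) \<longlonglongrightarrow> 0"
    and M: "M x < \<infinity>" and cont: "svf_continuous_at N a b F x"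
  \<comment> \<open>On a one-point interval uniform convergence is convergence at the point, so the
    uniform lemma covers the pointwise statement.\<close>
  have single: "uniform_limit {x..x} f (\<lambda>y. 0) sequentially \<longleftrightarrow> (\<lambda>n. f n x) \<longlonglongrightarrow> 0"
    for f :: "nat \<Rightarrow> real \<Rightarrow> real"
    by (simp add: uniform_limit_iff tendsto_iff)
  obtain C where C: "M x = ereal C" using M assms(5) x by (cases "M x") auto
  have C': "integral {a..b} (\<lambda>t. \<bar>K n y t\<bar>) \<le> C" if "y \<in> {x..x}" for n y
    using assms(6)[rule_format, OF x, of n] that C by simp
  from \<beta> obtain \<delta>0 where \<delta>0: "0 < \<delta>0" "\<And>\<delta>. 0 < \<delta> \<Longrightarrow> \<delta> < \<delta>0 \<Longrightarrow>
      (\<lambda>n. kernel_beta a b K n x \<delta>) \<longlonglongrightarrow> 0" by blast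
  have "uniform_limit {x..x} (\<lambda>n x. haus N (metric_operator N a b K n F x) (F x)) (\<lambda>x. 0) sequentially"
    by (rule metric_operator_uniform_limit[OF assms(1-3) _ _ _ _ \<delta>0(1) _ C'])
      (use assms(4) x cont \<alpha> \<delta>0(2) in \<open>auto simp: single simp del: atLeastAtMost_singleton\<close>)
  then show "(\<lambda>n. haus N (metric_operator N a b K n F x) (F x)) \<longlonglongrightarrow> 0"
    unfolding single .
qed

end
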